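(* Let $\alpha,\beta\in\mathbb{C}\setminus\mathbb{Z}^-$ with $\operatorname{Re}(\alpha+\beta)>-1$, let $k,l$ be non-negative integers, let $1\le p<\infty$, let $f\in L^p(\mathbb{T})$, and let $w=K_{\alpha,\beta}[f]$ be the $(\alpha,\beta)$-harmonic function on $\mathbb{D}$ with boundary function $f$. Let $C_{\alpha,\beta,k,l}$ be a constant, depending only on $\alpha,\beta,k,l$, such that $$\left|\partial^k\bar\partial^{\,l}u_{\alpha,\beta}(z)\right|\le C_{\alpha,\beta,k,l}\,\frac{|u_{\alpha,\beta}(z)|}{(1-|z|^2)^{k+l}}\qquad\text{for all }z\in\mathbb{D}.$$ Then for every $r\in[0,1)$, $$M_p\left(r,\partial^k\bar\partial^{\,l}w\right)\le\frac{|c_{\alpha,\beta}|\,C_{\alpha,\beta,k,l}}{(1-r^2)^{k+l}}\exp\left(\frac\pi2|\operatorname{Im}(\alpha-\beta)|\right)F\left(-\frac{\operatorname{Re}(\alpha+\beta)}{2},-\frac{\operatorname{Re}(\alpha+\beta)}{2};1;r^2\right)\|f\|_{L^p(\mathbb{T})}.$$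
   Context: $\mathbb{D}=\{z\in\mathbb{C}:|z|<1\}$, $\mathbb{T}=\{z\in\mathbb{C}:|z|=1\}$, and $\mathbb{Z}^-$ is the set of negative integers. $\partial=\partial_z=\frac12(\partial_x-i\partial_y)$, $\bar\partial=\partial_{\bar z}=\frac12(\partial_x+i\partial_y)$. Set $$u_{\alpha,\beta}(z)=\frac{(1-|z|^2)^{\alpha+\beta+1}}{(1-z)^{\alpha+1}(1-\bar z)^{\beta+1}}\quad(z\in\mathbb{D}),$$ with principal branches of the powers, $c_{\alpha,\beta}=\dfrac{\Gamma(\alpha+1)\Gamma(\beta+1)}{\Gamma(\alpha+\beta+1)}$, $K_{\alpha,\beta}=c_{\alpha,\beta}u_{\alpha,\beta}$, and $$K_{\alpha,\beta}[f](z)=\frac1{2\pi}\int_0^{2\pi}K_{\alpha,\beta}(ze^{-it})f(e^{it})\,dt ;$$ this is an $(\alpha,\beta)$-harmonic function, i.e. a $C^2$ solution in $\mathbb{D}$ of $(1-|z|^2)\partial_z\partial_{\bar z}w+\alpha z\partial_zw+\beta\bar z\partial_{\bar z}w-\alpha\beta w=0$. It is a known result that a constant $C_{\alpha,\beta,k,l}$ with the pointwise bound in the claim exists. The integral mean is $M_p(r,g)=\left(\frac1{2\pi}\int_0^{2\pi}|g(re^{i\theta})|^p\,d\theta\right)^{1/p}$, and $\|f\|_{L^p(\mathbb{T})}=\left(\frac1{2\pi}\int_0^{2\pi}|f(e^{i\theta})|^p\,d\theta\right)^{1/p}$. $F(a,b;c;x)=\sum_{n\ge0}\frac{(a)_n(b)_n}{(c)_n}\frac{x^n}{n!}$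 is the Gauss hypergeometric function, with $(a)_0=1$, $(a)_n=a(a+1)\cdots(a+n-1)$. *)

theory Defs
  imports "HOL-Analysis.Analysis"
begin

definition partial_x :: "(complex \<Rightarrow> complex) \<Rightarrow> complex \<Rightarrow> complex" where
  "partial_x g z = vector_derivative (\<lambda>s::real. g (z + of_real s)) (at 0)"

definition partial_y :: "(complex \<Rightarrow> complex) \<Rightarrow> complex \<Rightarrow> complex" where
  "partial_y g z = vector_derivative (\<lambda>s::real. g (z + \<i> * of_real s)) (at 0)"

(* The Wirtinger operators. Like vector_derivative, they are meaningful at points where the
   partial derivatives exist. *)
definition dz :: "(complex \<Rightarrow> complex) \<Rightarrow> complex \<Rightarrow> complex" where
  "dz g z = (partial_x g z - \<i> * partial_y g z) / 2"

definition dzbar :: "(complex \<Rightarrow> complex) \<Rightarrow> complex \<Rightarrow> complex" where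
  "dzbar g z = (partial_x g z + \<i> * partial_y g z) / 2"

definition u_kernel :: "complex \<Rightarrow> complex \<Rightarrow> complex \<Rightarrow> complex" where
  "u_kernel \<alpha> \<beta> z =
     of_real (1 - (norm z)\<^sup>2) powr (\<alpha> + \<beta> + 1) /
     ((1 - z) powr (\<alpha> + 1) * (1 - cnj z) powr (\<beta> + 1))"

definition c_const :: "complex \<Rightarrow> complex \<Rightarrow> complex" where
  "c_const \<alpha> \<beta> = Gamma (\<alpha> + 1) * Gamma (\<beta> + 1) / Gamma (\<alpha> + \<beta> + 1)"

definition K_kernel :: "complex \<Rightarrow> complex \<Rightarrow> complex \<Rightarrow> complex" where
  "K_kernel \<alpha> \<beta> z = c_const \<alpha> \<beta> * u_kernel \<alpha> \<beta> z"

(* Functions on the unit circle are functions on the complex plane of which only the values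
   at the points cis t, i.e. exp (i t), are used. *)
definition K_transform ::
    "complex \<Rightarrow> complex \<Rightarrow> (complex \<Rightarrow> complex) \<Rightarrow> complex \<Rightarrow> complex" where
  "K_transform \<alpha> \<beta> f z =
     of_real (1 / (2 * pi)) *
     (LINT t|lebesgue_on {0..2 * pi}. K_kernel \<alpha> \<beta> (z * cis (- t)) * f (cis t))"

definition Lp_circle :: "real \<Rightarrow> (complex \<Rightarrow> complex) set" where
  "Lp_circle p = {f. (\<lambda>t. f (cis t)) \<in> borel_measurable (lebesgue_on {0..2 * pi}) \<and>
                     integrable (lebesgue_on {0..2 * pi}) (\<lambda>t. norm (f (cis t)) powr p)}"

definition Lp_circle_norm :: "real \<Rightarrow> (complex \<Rightarrow> complex) \<Rightarrow> real" where
  "Lp_circle_norm p f =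
     (1 / (2 * pi) * (LINT t|lebesgue_on {0..2 * pi}. norm (f (cis t)) powr p)) powr (1 / p)"

definition integral_mean :: "real \<Rightarrow> real \<Rightarrow> (complex \<Rightarrow> complex) \<Rightarrow> real" where
  "integral_mean p r g =
     (1 / (2 * pi) *
       (LINT t|lebesgue_on {0..2 * pi}. norm (g (of_real r * cis t)) powr p)) powr (1 / p)"

definition hypergeo_F :: "real \<Rightarrow> real \<Rightarrow> real \<Rightarrow> real \<Rightarrow> real" where
  "hypergeo_F a b c x =
     (\<Sum>n. pochhammer a n * pochhammer b n / pochhammer c n * (x ^ n / fact n))"

end

theory Submission
  imports Defs
begin

text \<open>
  The function \<open>w\<close> is a convolution over the circle. Differentiating under the integral sign,
  each \<open>\<partial>\<close> moves onto the kernel at the cost of a unimodular factor \<open>e\<^sup>-\<^sup>i\<^sup>t\<close> (and each conjugate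
  derivative at the cost of \<open>e\<^sup>i\<^sup>t\<close>), so the assumed bound on the derivatives of \<open>u\<close> dominates the
  derivative of \<open>w\<close> by the convolution of \<open>|f|\<close> with a multiple of \<open>|u|\<close>. On \<open>|z| = r\<close>, with
  \<open>s = Re (\<alpha> + \<beta>)\<close>, the bound \<open>|Arg (1 - z)| < \<pi>/2\<close> gives
  \<open>|u(z)| \<le> exp (\<pi>/2 |Im (\<alpha> - \<beta>)|) (1 - r\<^sup>2)\<^bsup>s+1\<^esup> |1 - z|\<^bsup>-s-2\<^esup>\<close>. The mean of \<open>|1 - z|\<^bsup>-s-2\<^esup>\<close> is
  \<open>F(1 + s/2, 1 + s/2; 1; r\<^sup>2)\<close> by the binomial series and Parseval's identity, and Euler's
  transformation absorbs the power of \<open>1 - r\<^sup>2\<close>. Young's convolution inequality concludes.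
\<close>

section \<open>Wirtinger calculus on the disc\<close>

text \<open>Along the directions 1 and i the derivative takes the values a + b and i (a - b), which
  are the two partial derivatives. Every real-linear map of the plane has the form a h + b cnj h, so
  this links the operators, defined by partial derivatives only, to real Frechet
  derivatives.\<close>

lemma wirtinger_of_has_derivative:
  assumes "(g has_derivative (\<lambda>h. a * h + b * cnj h)) (at z)"
  shows "dz g z = a" and "dzbar g z = b"
proof -
  have "((\<lambda>s::real. g (z + e * of_real s)) has_derivative (\<lambda>s. a * (e * of_real s) + b * cnj (e * of_real s))) (at 0)"
    for e
  proof -
    have "((\<lambda>s::real. z + e * of_real s) has_derivative (\<lambda>s. e * of_real s)) (at 0)"
      by (auto intro!: derivative_eq_intros)
    moreover have "(g has_derivative (\<lambda>h. a * h + b * cnj h)) (at (z + e * of_real 0))"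
      using assms by simp
    ultimately show ?thesis by (rule has_derivative_compose)
  qed
  moreover have "(\<lambda>s. a * (e * of_real s) + b * cnj (e * of_real s)) = (\<lambda>s. s *\<^sub>R (a * e + b * cnj e))" for e
    by (auto simp: scaleR_conv_of_real algebra_simps)
  ultimately have vd: "vector_derivative (\<lambda>s::real. g (z + e * of_real s)) (at 0) = a * e + b * cnj e" for e
    by (intro vector_derivative_at) (simp add: has_vector_derivative_def)
  have "partial_x g z = a + b" "partial_y g z = a * \<i> + b * - \<i>"
    using vd[of 1] vd[of \<i>] by (simp_all add: partial_x_def partial_y_def)
  then show "dz g z = a" "dzbar g z = b"
    by (simp_all add: dz_def dzbar_def complex_eq_iff)
qed

lemma wirtinger_bounded_linear: "bounded_linear (\<lambda>h. a * h + b * cnj h)"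
  by (intro bounded_linear_add bounded_linear_mult_right
      bounded_linear_compose[OF bounded_linear_mult_right bounded_linear_cnj])

lemma has_derivative_cong_ball:
  fixes g :: "complex \<Rightarrow> complex"
  assumes "(g has_derivative D) (at z)" and "norm z < 1" and "\<And>z. norm z < 1 \<Longrightarrow> g z = g' z"
  shows "(g' has_derivative D) (at z)"
  using assms by (intro has_derivative_transform_within_open[of g D z UNIV "ball 0 1" g']) auto

text \<open>Both operators see a function only near the point. Identities known merely inside the
  disc can therefore be differentiated again, as the inductions on iterated derivatives
  require.\<close>

lemma wirtinger_cong_ball:
  assumes "\<And>z. norm z < 1 \<Longrightarrow> g z = g' z" and "norm z < 1"
  shows "dz g z = dz g' z" and "dzbar g z = dzbar g' z"
proof -
  have ev: "\<forall>\<^sub>F s in nhds (0::real). g (z + e * of_real s) = g' (z + e * of_real s)" for e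
  proof -
    have "\<forall>\<^sub>F w in nhds z. g w = g' w"
      using assms by (intro eventually_nhds[THEN iffD2] exI[of _ "ball 0 1"]) auto
    moreover have "filterlim (\<lambda>s::real. z + e * of_real s) (nhds z) (nhds 0)"
    proof -
      have "((\<lambda>s::real. z + e * of_real s) \<longlongrightarrow> z + e * of_real 0) (nhds 0)"
        by (intro tendsto_intros filterlim_ident)
      then show ?thesis by simp
    qed
    ultimately show ?thesis by (rule eventually_compose_filterlim)
  qed
  have "vector_derivative (\<lambda>s::real. g (z + e * of_real s)) (at 0)
      = vector_derivative (\<lambda>s::real. g' (z + e * of_real s)) (at 0)" for e
    by (rule vector_derivative_cong_eq) (use ev[of e] eventually_nhds_x_imp_x[OF ev[of e]] in auto)
  from this[of 1] this[of \<i>] have "partial_x g z = partial_x g' z" "partial_y g z = partial_y g' z"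
    by (simp_all add: partial_x_def partial_y_def)
  then show "dz g z = dz g' z" "dzbar g z = dzbar g' z" by (simp_all add: dz_def dzbar_def)
qed

text \<open>The class C^n on the disc, phrased through Wirtinger derivatives: at each stage
  \<open>dz g\<close> and \<open>dzbar g\<close> are the coefficients of a genuine real derivative,
  and the last ones are continuous.\<close>

primrec disc_smooth :: "nat \<Rightarrow> (complex \<Rightarrow> complex) \<Rightarrow> bool" where
  "disc_smooth 0 g \<longleftrightarrow> continuous_on (ball 0 1) g"
| "disc_smooth (Suc n) g \<longleftrightarrow>
     (\<forall>z. norm z < 1 \<longrightarrow> (g has_derivative (\<lambda>h. dz g z * h + dzbar g z * cnj h)) (at z))
     \<and> disc_smooth n (dz g) \<and> disc_smooth n (dzbar g)"

lemma disc_smooth_cong: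
  assumes "disc_smooth n g" and "\<And>z. norm z < 1 \<Longrightarrow> g z = g' z"
  shows "disc_smooth n g'"
  using assms
proof (induction n arbitrary: g g')
  case 0
  then show ?case using continuous_on_cong[of "ball 0 1" "ball 0 1" g g'] by auto
next
  case (Suc n)
  note eq = wirtinger_cong_ball[of g g', OF Suc.prems(2)]
  have "(g' has_derivative (\<lambda>h. dz g' z * h + dzbar g' z * cnj h)) (at z)" if "norm z < 1" for z
    using has_derivative_cong_ball[of g _ z g'] Suc.prems that eq by simp
  moreover have "disc_smooth n (dz g')" "disc_smooth n (dzbar g')"
    using Suc.IH[of "dz g" "dz g'"] Suc.IH[of "dzbar g" "dzbar g'"] Suc.prems(1) eq by auto
  ultimately show ?case by simp
qed

text \<open>A closure proof may offer any formulas for the two derivatives. They are tied to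
  \<open>dz g\<close> and \<open>dzbar g\<close> inside the disc only, so smoothness is carried over
  by \<open>disc_smooth_cong\<close>.\<close>

lemma disc_smooth_SucI:
  assumes "\<And>z. norm z < 1 \<Longrightarrow> (g has_derivative (\<lambda>h. a z * h + b z * cnj h)) (at z)"
    and "disc_smooth n a" and "disc_smooth n b"
  shows "disc_smooth (Suc n) g"
proof -
  have eq: "dz g z = a z" "dzbar g z = b z" if "norm z < 1" for z
    using wirtinger_of_has_derivative[OF assms(1)[OF that]] by auto
  then show ?thesis
    using assms disc_smooth_cong[of n a "dz g"] disc_smooth_cong[of n b "dzbar g"] by simp
qed

lemma disc_smooth_has_derivative:
  "disc_smooth (Suc n) g \<Longrightarrow> norm z < 1 \<Longrightarrow>
     (g has_derivative (\<lambda>h. dz g z * h + dzbar g z * cnj h)) (at z)"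
  by simp

lemma disc_smooth_Suc_lower: "disc_smooth (Suc n) g \<Longrightarrow> disc_smooth n g"
proof (induction n arbitrary: g)
  case 0
  have "isCont g z" if "norm z < 1" for z
    using has_derivative_continuous[OF disc_smooth_has_derivative[OF 0 that]] .
  then show ?case by (auto intro!: continuous_at_imp_continuous_on)
next
  case (Suc n)
  have "disc_smooth (Suc n) (dz g)" "disc_smooth (Suc n) (dzbar g)"
    using Suc.prems unfolding disc_smooth.simps(2)[of "Suc n"] by blast+
  then have "disc_smooth n (dz g)" "disc_smooth n (dzbar g)" by (auto intro: Suc.IH simp del: disc_smooth.simps)
  then show ?case using disc_smooth_has_derivative[OF Suc.prems] unfolding disc_smooth.simps(2)[of n] by blast
qed

lemma disc_smooth_imp_continuous: "disc_smooth n g \<Longrightarrow> continuous_on (ball 0 1) g"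
proof (induction n)
  case (Suc n)
  show ?case by (rule Suc.IH[OF disc_smooth_Suc_lower[OF Suc.prems]])
qed simp

lemma disc_smooth_const: "disc_smooth n (\<lambda>z. c)"
proof (induction n arbitrary: c)
  case (Suc n)
  then show ?case by (intro disc_smooth_SucI[where a = "\<lambda>_. 0" and b = "\<lambda>_. 0"]) auto
qed auto

lemma disc_smooth_ident: "disc_smooth n (\<lambda>z. z)"
proof (cases n)
  case (Suc m)
  show ?thesis unfolding Suc
    by (intro disc_smooth_SucI[where a = "\<lambda>_. 1" and b = "\<lambda>_. 0"] disc_smooth_const) auto
qed auto

lemma disc_smooth_cnj: "disc_smooth n cnj"
proof (cases n)
  case (Suc m)
  show ?thesis unfolding Suc
    by (intro disc_smooth_SucI[where a = "\<lambda>_. 0" and b = "\<lambda>_. 1"] disc_smooth_const)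
      (simp_all add: bounded_linear_imp_has_derivative[OF bounded_linear_cnj])
qed (simp add: continuous_on_cnj)

lemma disc_smooth_add:
  "disc_smooth n g \<Longrightarrow> disc_smooth n h \<Longrightarrow> disc_smooth n (\<lambda>z. g z + h z)"
proof (induction n arbitrary: g h)
  case 0
  then show ?case by (simp add: continuous_on_add)
next
  case (Suc n)
  show ?case
  proof (rule disc_smooth_SucI)
    show "((\<lambda>z. g z + h z) has_derivative
        (\<lambda>x. (dz g z + dz h z) * x + (dzbar g z + dzbar h z) * cnj x)) (at z)" if "norm z < 1" for z
      by (rule has_derivative_eq_rhs[OF has_derivative_add[OF Suc.prems[THEN disc_smooth_has_derivative, OF that]]])
        (auto simp: algebra_simps)
  qed (use Suc in auto)
qed

lemma disc_smooth_mult: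
  "disc_smooth n g \<Longrightarrow> disc_smooth n h \<Longrightarrow> disc_smooth n (\<lambda>z. g z * h z)"
proof (induction n arbitrary: g h)
  case 0
  then show ?case by (simp add: continuous_on_mult)
next
  case (Suc n)
  show ?case
  proof (rule disc_smooth_SucI)
    show "((\<lambda>z. g z * h z) has_derivative (\<lambda>x. (g z * dz h z + dz g z * h z) * x
        + (g z * dzbar h z + dzbar g z * h z) * cnj x)) (at z)" if "norm z < 1" for z
      by (rule has_derivative_eq_rhs[OF has_derivative_mult[OF Suc.prems[THEN disc_smooth_has_derivative, OF that]]])
        (auto simp: algebra_simps)
    \<comment> \<open>The product rule leaves one factor undifferentiated, so both functions are
      also needed at the lower order.\<close>
    have "disc_smooth n g" "disc_smooth n h" by (rule Suc.prems[THEN disc_smooth_Suc_lower])+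
    then show "disc_smooth n (\<lambda>z. g z * dz h z + dz g z * h z)"
      "disc_smooth n (\<lambda>z. g z * dzbar h z + dzbar g z * h z)"
      using Suc.prems by (auto intro!: disc_smooth_add Suc.IH)
  qed
qed

text \<open>Off the slit the principal power is holomorphic and the chain rule applies.
  Differentiation turns the exponent \<open>a\<close> into \<open>a - 1\<close>, so the induction
  generalizes \<open>a\<close> while \<open>g\<close> stays fixed.\<close>

lemma disc_smooth_powr:
  assumes "\<And>n. disc_smooth n g" and slit: "\<And>z. norm z < 1 \<Longrightarrow> g z \<notin> \<real>\<^sub>\<le>\<^sub>0"
  shows "disc_smooth n (\<lambda>z. g z powr a)"
proof (induction n arbitrary: a)
  case 0
  have "continuous_on (ball 0 1) g" using assms(1)[of 0] by simp
  moreover have "\<And>z. z \<in> ball 0 1 \<Longrightarrow> g z \<notin> \<real>\<^sub>\<le>\<^sub>0" using slit by simp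
  ultimately show ?case
    by (simp, intro continuous_on_powr_complex)
      (force simp: complex_nonpos_Reals_iff)+
next
  case (Suc n)
  show ?case
  proof (rule disc_smooth_SucI)
    show "((\<lambda>z. g z powr a) has_derivative (\<lambda>x. (a * g z powr (a - 1) * dz g z) * x
        + (a * g z powr (a - 1) * dzbar g z) * cnj x)) (at z)" if "norm z < 1" for z
    proof -
      have "(g has_derivative (\<lambda>h. dz g z * h + dzbar g z * cnj h)) (at z)"
        using assms(1)[of "Suc 0"] that by simp
      moreover have "((\<lambda>w. w powr a) has_derivative (*) (a * g z powr (a - 1))) (at (g z))"
        using has_field_derivative_powr[OF slit[OF that]] by (simp add: has_field_derivative_def)
      ultimately have "((\<lambda>z. g z powr a) has_derivative
          (\<lambda>h. a * g z powr (a - 1) * (dz g z * h + dzbar g z * cnj h))) (at z)"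
        by (rule has_derivative_compose)
      then show ?thesis by (simp add: algebra_simps)
    qed
    have "disc_smooth n (dz g)" "disc_smooth n (dzbar g)" using assms(1)[of "Suc n"] by auto
    then show "disc_smooth n (\<lambda>z. a * g z powr (a - 1) * dz g z)"
      "disc_smooth n (\<lambda>z. a * g z powr (a - 1) * dzbar g z)"
      by (auto intro!: disc_smooth_mult disc_smooth_const Suc.IH)
  qed
qed

lemma disc_smooth_u_kernel: "disc_smooth n (u_kernel \<alpha> \<beta>)"
proof -
  \<comment> \<open>With |z|^2 written as \<open>z * cnj z\<close>, negative exponents for the
    denominator and differences as sums, the kernel is covered by the closure lemmas. All three
    bases have positive real part in the disc.\<close>
  have rw: "u_kernel \<alpha> \<beta> z = (1 + (-1) * (z * cnj z)) powr (\<alpha> + \<beta> + 1)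
      * ((1 + (-1) * z) powr (- (\<alpha> + 1)) * (1 + (-1) * cnj z) powr (- (\<beta> + 1)))" for z
    unfolding u_kernel_def powr_minus divide_inverse
    by (simp flip: complex_norm_square)
  have pos: "w \<notin> \<real>\<^sub>\<le>\<^sub>0" if "Re w > 0" for w :: complex
    using that by (auto simp: complex_nonpos_Reals_iff)
  have "disc_smooth n (\<lambda>z. (1 + (-1) * (z * cnj z)) powr (\<alpha> + \<beta> + 1)
      * ((1 + (-1) * z) powr (- (\<alpha> + 1)) * (1 + (-1) * cnj z) powr (- (\<beta> + 1))))"
  proof (intro disc_smooth_mult disc_smooth_powr disc_smooth_add disc_smooth_const disc_smooth_ident disc_smooth_cnj pos)
    fix z :: complex assume "norm z < 1"
    then have "(norm z)\<^sup>2 < 1" by (simp add: abs_square_less_1)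
    then show "Re (1 + - 1 * (z * cnj z)) > 0"
      by (simp flip: complex_norm_square)
    have "Re z < 1" using complex_Re_le_cmod[of z] \<open>norm z < 1\<close> by linarith
    then show "Re (1 + - 1 * z) > 0" "Re (1 + - 1 * cnj z) > 0" by simp_all
  qed
  then show ?thesis by (simp only: rw[symmetric])
qed

lemma disc_smooth_funpow_dz: "disc_smooth (n + k) g \<Longrightarrow> disc_smooth n ((dz ^^ k) g)"
proof (induction k arbitrary: n)
  case (Suc k)
  then have "disc_smooth (Suc n) ((dz ^^ k) g)" by (intro Suc.IH) (simp only: add_Suc add_Suc_right)
  then show ?case by simp
qed simp

lemma disc_smooth_funpow_dzbar: "disc_smooth (n + k) g \<Longrightarrow> disc_smooth n ((dzbar ^^ k) g)"
proof (induction k arbitrary: n)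
  case (Suc k)
  then have "disc_smooth (Suc n) ((dzbar ^^ k) g)" by (intro Suc.IH) (simp only: add_Suc add_Suc_right)
  then show ?case by simp
qed simp

text \<open>The mean value inequality together with uniform continuity of both derivatives on a
  compact disc. The bound is uniform in \<open>a\<close>; differentiation under the integral needs
  it along a whole circle.\<close>

lemma disc_smooth_uniform_linearization:
  assumes "disc_smooth 1 g" and "\<rho> < 1" and "\<epsilon> > 0"
  obtains \<delta> where "\<delta> > 0" and
    "\<And>a h. norm a \<le> \<rho> \<Longrightarrow> norm h < \<delta> \<Longrightarrow>
       norm (g (a + h) - g a - (dz g a * h + dzbar g a * cnj h)) \<le> \<epsilon> * norm h"
proof -
  \<comment> \<open>A radius strictly between \<rho> and 1 leaves room for the increment inside a
    compact disc.\<close>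
  define \<sigma> where "\<sigma> = (1 + \<rho>) / 2"
  have \<sigma>: "\<rho> < \<sigma>" "\<sigma> < 1" using assms(2) by (auto simp: \<sigma>_def)
  have uc: "uniformly_continuous_on (cball 0 \<sigma>) (dz g)" "uniformly_continuous_on (cball 0 \<sigma>) (dzbar g)"
  proof -
    have "continuous_on (ball 0 1) (dz g)" "continuous_on (ball 0 1) (dzbar g)" using assms(1) by auto
    moreover have "cball 0 \<sigma> \<subseteq> ball (0::complex) 1" using \<sigma> by auto
    ultimately show "uniformly_continuous_on (cball 0 \<sigma>) (dz g)" "uniformly_continuous_on (cball 0 \<sigma>) (dzbar g)"
      by (auto intro!: compact_uniformly_continuous intro: continuous_on_subset)
  qed
  have "\<epsilon> / 2 > 0" using assms(3) by simp
  obtain d1 where d1: "d1 > 0" "\<And>x y. x \<in> cball 0 \<sigma> \<Longrightarrow> y \<in> cball 0 \<sigma> \<Longrightarrow> dist y x < d1 \<Longrightarrow> dist (dz g y) (dz g x) < \<epsilon> / 2"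
    using uc(1) \<open>\<epsilon> / 2 > 0\<close> unfolding uniformly_continuous_on_def by blast
  obtain d2 where d2: "d2 > 0" "\<And>x y. x \<in> cball 0 \<sigma> \<Longrightarrow> y \<in> cball 0 \<sigma> \<Longrightarrow> dist y x < d2 \<Longrightarrow> dist (dzbar g y) (dzbar g x) < \<epsilon> / 2"
    using uc(2) \<open>\<epsilon> / 2 > 0\<close> unfolding uniformly_continuous_on_def by blast
  define \<delta> where "\<delta> = min (min d1 d2) (\<sigma> - \<rho>)"
  have "\<delta> > 0" using d1 d2 \<sigma> by (simp add: \<delta>_def)
  moreover have "norm (g (a + h) - g a - (dz g a * h + dzbar g a * cnj h)) \<le> \<epsilon> * norm h"
    if "norm a \<le> \<rho>" "norm h < \<delta>" for a h
  proof -
    \<comment> \<open>With the linear part at \<open>a\<close> removed, the derivative at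
      \<open>x\<close> is the change of the derivative from \<open>a\<close> to \<open>x\<close>,
      and each of its two coefficients contributes at most \<epsilon> / 2.\<close>
    define G where "G x = g x - (dz g a * x + dzbar g a * cnj x)" for x
    have "norm (G (a + h) - G a) \<le> \<epsilon> * norm (a + h - a)"
    proof (rule differentiable_bound)
      show "convex (ball a \<delta>)" by simp
      show "a + h \<in> ball a \<delta>" "a \<in> ball a \<delta>" using that \<open>\<delta> > 0\<close> by (auto simp: dist_norm)
      fix x assume x: "x \<in> ball a \<delta>"
      then have "norm (x - a) < \<delta>" by (simp add: dist_norm norm_minus_commute)
      then have "norm x < \<sigma>" using that norm_triangle_ineq[of a "x - a"] by (simp add: \<delta>_def)
      then have "(g has_derivative (\<lambda>h. dz g x * h + dzbar g x * cnj h)) (at x)"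
        using assms(1) \<sigma> by simp
      then show "(G has_derivative (\<lambda>h. (dz g x * h + dzbar g x * cnj h) - (dz g a * h + dzbar g a * cnj h)))
          (at x within ball a \<delta>)"
        unfolding G_def
        by (rule has_derivative_at_withinI[OF has_derivative_diff[OF _
              bounded_linear_imp_has_derivative[OF wirtinger_bounded_linear]]])
      show "onorm (\<lambda>h. (dz g x * h + dzbar g x * cnj h) - (dz g a * h + dzbar g a * cnj h)) \<le> \<epsilon>"
      proof (rule onorm_le)
        fix y
        have "(dz g x * y + dzbar g x * cnj y) - (dz g a * y + dzbar g a * cnj y)
          = (dz g x - dz g a) * y + (dzbar g x - dzbar g a) * cnj y" by (simp add: algebra_simps)
        also have "norm \<dots> \<le> norm (dz g x - dz g a) * norm y + norm (dzbar g x - dzbar g a) * norm y"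
          by (metis complex_mod_cnj norm_mult norm_triangle_ineq)
        also have "\<dots> \<le> \<epsilon> / 2 * norm y + \<epsilon> / 2 * norm y"
          using d1(2)[of a x] d2(2)[of a x] that \<sigma> \<open>norm x < \<sigma>\<close> \<open>norm (x - a) < \<delta>\<close>
          by (intro add_mono mult_right_mono) (auto simp: dist_norm \<delta>_def)
        finally show "norm ((dz g x * y + dzbar g x * cnj y) - (dz g a * y + dzbar g a * cnj y)) \<le> \<epsilon> * norm y"
          by simp
      qed
    qed
    then show ?thesis by (simp add: G_def algebra_simps)
  qed
  ultimately show ?thesis by (rule that)
qed

section \<open>Convolution over the circle\<close>

abbreviation circle_measure :: "real measure" where
  "circle_measure \<equiv> lebesgue_on {0..2 * pi}"

lemma integrable_continuous_mult:
  fixes k \<phi> :: "real \<Rightarrow> 'a::{real_normed_algebra,second_countable_topology,banach}"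
  assumes "continuous_on {a..b} k" and "integrable (lebesgue_on {a..b}) \<phi>"
  shows "integrable (lebesgue_on {a..b}) (\<lambda>t. k t * \<phi> t)"
proof -
  have "compact (k ` {a..b})" using assms(1) by (intro compact_continuous_image) auto
  then obtain B where "\<forall>x\<in>k ` {a..b}. norm x \<le> B"
    using compact_imp_bounded bounded_iff by blast
  then have B: "norm (k t) \<le> B" if "t \<in> {a..b}" for t
    using that by blast
  have meas: "(\<lambda>t. k t * \<phi> t) \<in> borel_measurable (lebesgue_on {a..b})"
    by (intro borel_measurable_times borel_measurable_integrable[OF assms(2)]
        continuous_imp_measurable_on_sets_lebesgue assms(1)) auto
  show ?thesis
  proof (rule Bochner_Integration.integrable_bound)
    show "integrable (lebesgue_on {a..b}) (\<lambda>t. B * norm (\<phi> t))" using assms(2) by simp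
    have "norm (k t * \<phi> t) \<le> norm (B * norm (\<phi> t))" if "t \<in> {a..b}" for t
    proof -
      have "0 \<le> B" using B[OF that] norm_ge_zero[of "k t"] by linarith
      have "norm (k t * \<phi> t) \<le> norm (k t) * norm (\<phi> t)" by (rule norm_mult_ineq)
      also have "\<dots> \<le> B * norm (\<phi> t)" using B[OF that] by (intro mult_right_mono) auto
      finally show ?thesis using \<open>0 \<le> B\<close> by simp
    qed
    then show "AE t in lebesgue_on {a..b}. norm (k t * \<phi> t) \<le> norm (B * norm (\<phi> t))"
      by (intro AE_I2) (auto simp: space_restrict_space)
  qed (rule meas)
qed

text \<open>The density \<open>\<phi>\<close> absorbs constants and the unimodular factors of the
  chain rule, so derivatives of such convolutions are again of this form.\<close>

definition circle_conv :: "(complex \<Rightarrow> complex) \<Rightarrow> (real \<Rightarrow> complex) \<Rightarrow> complex \<Rightarrow> complex" where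
  "circle_conv g \<phi> z = (LINT t|circle_measure. g (z * cis (- t)) * \<phi> t)"

lemma continuous_on_rotated:
  assumes "continuous_on (ball 0 1) g" and "norm z < 1"
  shows "continuous_on S (\<lambda>t. g (z * cis (- t)))"
  by (rule continuous_on_compose2[OF assms(1)]) (use assms(2) in \<open>auto intro!: continuous_intros simp: norm_mult\<close>)

lemma integrable_circle_conv:
  fixes g :: "complex \<Rightarrow> complex"
  assumes "continuous_on (ball 0 1) g" and "norm z < 1" and "integrable circle_measure \<phi>"
  shows "integrable circle_measure (\<lambda>t. g (z * cis (- t)) * \<phi> t)"
  by (rule integrable_continuous_mult[OF continuous_on_rotated[OF assms(1,2)] assms(3)])

lemma integrable_cis_mult:
  assumes "integrable circle_measure \<phi>"
  shows "integrable circle_measure (\<lambda>t. cis (c * t) * \<phi> t)"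
  by (rule integrable_continuous_mult[OF _ assms]) (intro continuous_intros)

text \<open>Differentiation under the integral: an increment \<open>h\<close> of \<open>z\<close>
  moves the argument of \<open>g\<close> by \<open>h * cis (- t)\<close>, which puts
  \<open>cis (- t)\<close> beside \<open>dz g\<close> and its conjugate \<open>cis t\<close> beside
  \<open>dzbar g\<close>. The remainder is at most \<epsilon> |h| |\<phi> t| for all
  \<open>t\<close> at once.\<close>

lemma circle_conv_has_derivative:
  assumes g: "disc_smooth 1 g" and "norm z < 1" and \<phi>: "integrable circle_measure \<phi>"
  shows "(circle_conv g \<phi> has_derivative
    (\<lambda>h. circle_conv (dz g) (\<lambda>t. cis (- t) * \<phi> t) z * h
       + circle_conv (dzbar g) (\<lambda>t. cis t * \<phi> t) z * cnj h)) (at z)"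
  unfolding has_derivative_at_alt
proof (intro conjI allI impI)
  let ?P = "circle_conv (dz g) (\<lambda>t. cis (- t) * \<phi> t) z"
  let ?Q = "circle_conv (dzbar g) (\<lambda>t. cis t * \<phi> t) z"
  show "bounded_linear (\<lambda>h. ?P * h + ?Q * cnj h)" by (rule wirtinger_bounded_linear)
  fix e :: real assume "e > 0"
  define J where "J = (LINT t|circle_measure. norm (\<phi> t))"
  have "J \<ge> 0" unfolding J_def by simp
  \<comment> \<open>The summand 1 keeps the quotient meaningful when \<phi> has norm zero.\<close>
  define \<epsilon> where "\<epsilon> = e / (J + 1)"
  have "\<epsilon> > 0" using \<open>e > 0\<close> \<open>J \<ge> 0\<close> by (simp add: \<epsilon>_def)
  have "\<epsilon> * J \<le> e" using \<open>e > 0\<close> \<open>J \<ge> 0\<close> by (simp add: \<epsilon>_def field_simps)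
  obtain d where d: "d > 0" "\<And>a h. norm a \<le> norm z \<Longrightarrow> norm h < d \<Longrightarrow>
      norm (g (a + h) - g a - (dz g a * h + dzbar g a * cnj h)) \<le> \<epsilon> * norm h"
    using disc_smooth_uniform_linearization[OF g \<open>norm z < 1\<close> \<open>\<epsilon> > 0\<close>] by blast
  have cont: "continuous_on (ball 0 1) g" "continuous_on (ball 0 1) (dz g)" "continuous_on (ball 0 1) (dzbar g)"
    using g disc_smooth_imp_continuous[OF g] by auto
  have "norm (circle_conv g \<phi> y - circle_conv g \<phi> z - (?P * (y - z) + ?Q * cnj (y - z))) \<le> e * norm (y - z)"
    if y: "norm (y - z) < min d (1 - norm z)" for y
  proof -
    define h where "h = y - z"
    have "norm y < 1" using y norm_triangle_ineq[of z "y - z"] by simp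
    let ?X = "\<lambda>t. g (y * cis (- t)) - g (z * cis (- t))
       - (dz g (z * cis (- t)) * (h * cis (- t)) + dzbar g (z * cis (- t)) * cnj (h * cis (- t)))"
    have int: "integrable circle_measure (\<lambda>t. g (y * cis (- t)) * \<phi> t)"
       "integrable circle_measure (\<lambda>t. g (z * cis (- t)) * \<phi> t)"
       "integrable circle_measure (\<lambda>t. dz g (z * cis (- t)) * (cis (- t) * \<phi> t))"
       "integrable circle_measure (\<lambda>t. dzbar g (z * cis (- t)) * (cis t * \<phi> t))"
      using integrable_cis_mult[OF \<phi>, of "-1"] integrable_cis_mult[OF \<phi>, of 1]
      by (auto intro!: integrable_circle_conv cont \<open>norm y < 1\<close> \<open>norm z < 1\<close> \<phi>)
    have hb: "has_bochner_integral circle_measure (\<lambda>t. g (y * cis (- t)) * \<phi> t - g (z * cis (- t)) * \<phi> t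
         - (dz g (z * cis (- t)) * (cis (- t) * \<phi> t) * h + dzbar g (z * cis (- t)) * (cis t * \<phi> t) * cnj h))
      (circle_conv g \<phi> y - circle_conv g \<phi> z - (?P * h + ?Q * cnj h))"
      unfolding circle_conv_def
      by (intro has_bochner_integral_diff has_bochner_integral_add has_bochner_integral_mult_left
          has_bochner_integral_integrable int)
    have eq: "g (y * cis (- t)) * \<phi> t - g (z * cis (- t)) * \<phi> t
         - (dz g (z * cis (- t)) * (cis (- t) * \<phi> t) * h + dzbar g (z * cis (- t)) * (cis t * \<phi> t) * cnj h)
       = ?X t * \<phi> t" for t
      by (simp add: algebra_simps cis_cnj)
    from hb have hb: "has_bochner_integral circle_measure (\<lambda>t. ?X t * \<phi> t)
        (circle_conv g \<phi> y - circle_conv g \<phi> z - (?P * h + ?Q * cnj h))"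
      by (simp only: eq)
    have "norm (LINT t|circle_measure. ?X t * \<phi> t) \<le> (LINT t|circle_measure. \<epsilon> * norm h * norm (\<phi> t))"
    proof (rule Bochner_Integration.integral_norm_bound_integral)
      show "integrable circle_measure (\<lambda>t. ?X t * \<phi> t)" using hb by (rule integrable.intros)
      show "integrable circle_measure (\<lambda>t. \<epsilon> * norm h * norm (\<phi> t))" using \<phi> by simp
      fix t
      have "z * cis (- t) + h * cis (- t) = y * cis (- t)" by (simp add: h_def algebra_simps)
      then have "norm (?X t) \<le> \<epsilon> * norm (h * cis (- t))"
        using d(2)[of "z * cis (- t)" "h * cis (- t)"] y by (simp add: h_def norm_mult)
      then show "norm (?X t * \<phi> t) \<le> \<epsilon> * norm h * norm (\<phi> t)"
        by (simp add: norm_mult mult_right_mono)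
    qed
    also have "\<dots> = (\<epsilon> * J) * norm h" by (simp add: J_def)
    also have "\<dots> \<le> e * norm h" using \<open>\<epsilon> * J \<le> e\<close> by (intro mult_right_mono) auto
    finally show ?thesis using has_bochner_integral_integral_eq[OF hb] by (simp add: h_def)
  qed
  then show "\<exists>d>0. \<forall>y. norm (y - z) < d \<longrightarrow>
      norm (circle_conv g \<phi> y - circle_conv g \<phi> z - (?P * (y - z) + ?Q * cnj (y - z))) \<le> e * norm (y - z)"
    using d(1) \<open>norm z < 1\<close> by (intro exI[of _ "min d (1 - norm z)"]) auto
qed

text \<open>Each \<open>dzbar\<close> multiplies the density by \<open>cis t\<close>. The induction
  hypothesis holds only in the disc and is differentiated by locality.\<close>

lemma funpow_dzbar_circle_conv:
  assumes "disc_smooth l g" and "norm z < 1" and "integrable circle_measure \<phi>"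
  shows "(dzbar ^^ l) (circle_conv g \<phi>) z = circle_conv ((dzbar ^^ l) g) (\<lambda>t. cis (real l * t) * \<phi> t) z"
  using assms(1,2)
proof (induction l arbitrary: z)
  case (Suc l)
  have "disc_smooth l g" using Suc.prems(1) by (rule disc_smooth_Suc_lower)
  have sm: "disc_smooth 1 ((dzbar ^^ l) g)"
    using disc_smooth_funpow_dzbar[of 1 l g] Suc.prems(1) by simp
  have "(dzbar ^^ Suc l) (circle_conv g \<phi>) z = dzbar (circle_conv ((dzbar ^^ l) g) (\<lambda>t. cis (real l * t) * \<phi> t)) z"
    unfolding funpow.simps o_apply
    by (rule wirtinger_cong_ball[OF Suc.IH[OF \<open>disc_smooth l g\<close>] Suc.prems(2)])
  also have "\<dots> = circle_conv (dzbar ((dzbar ^^ l) g)) (\<lambda>t. cis t * (cis (real l * t) * \<phi> t)) z"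
    by (rule wirtinger_of_has_derivative(2)[OF circle_conv_has_derivative[OF sm Suc.prems(2) integrable_cis_mult[OF assms(3)]]])
  finally have "(dzbar ^^ Suc l) (circle_conv g \<phi>) z = \<dots>" .
  moreover have "cis t * (cis (real l * t) * \<phi> t) = cis (real (Suc l) * t) * \<phi> t" for t
  proof -
    have "t + real l * t = real (Suc l) * t" by (simp add: algebra_simps)
    then show ?thesis by (simp only: mult.assoc[symmetric] cis_mult)
  qed
  ultimately show ?case by (simp only: funpow.simps o_apply)
qed simp

lemma funpow_dz_circle_conv:
  assumes "disc_smooth k g" and "norm z < 1" and "integrable circle_measure \<phi>"
  shows "(dz ^^ k) (circle_conv g \<phi>) z = circle_conv ((dz ^^ k) g) (\<lambda>t. cis (- real k * t) * \<phi> t) z"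
  using assms(1,2)
proof (induction k arbitrary: z)
  case (Suc k)
  have "disc_smooth k g" using Suc.prems(1) by (rule disc_smooth_Suc_lower)
  have sm: "disc_smooth 1 ((dz ^^ k) g)"
    using disc_smooth_funpow_dz[of 1 k g] Suc.prems(1) by simp
  have "(dz ^^ Suc k) (circle_conv g \<phi>) z = dz (circle_conv ((dz ^^ k) g) (\<lambda>t. cis (- real k * t) * \<phi> t)) z"
    unfolding funpow.simps o_apply
    by (rule wirtinger_cong_ball[OF Suc.IH[OF \<open>disc_smooth k g\<close>] Suc.prems(2)])
  also have "\<dots> = circle_conv (dz ((dz ^^ k) g)) (\<lambda>t. cis (- t) * (cis (- real k * t) * \<phi> t)) z"
    by (rule wirtinger_of_has_derivative(1)[OF circle_conv_has_derivative[OF sm Suc.prems(2) integrable_cis_mult[OF assms(3)]]])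
  finally have "(dz ^^ Suc k) (circle_conv g \<phi>) z = \<dots>" .
  moreover have "cis (- t) * (cis (- real k * t) * \<phi> t) = cis (- real (Suc k) * t) * \<phi> t" for t
  proof -
    have "- t + - real k * t = - real (Suc k) * t" by (simp add: algebra_simps)
    then show ?thesis by (simp only: mult.assoc[symmetric] cis_mult)
  qed
  ultimately show ?case by (simp only: funpow.simps o_apply)
qed simp

lemma funpow_dz_cong_ball:
  assumes "\<And>z. norm z < 1 \<Longrightarrow> g z = g' z" and "norm z < 1"
  shows "(dz ^^ k) g z = (dz ^^ k) g' z"
  using assms(2)
proof (induction k arbitrary: z)
  case (Suc k)
  show ?case unfolding funpow.simps o_apply by (rule wirtinger_cong_ball(1)[OF Suc.IH Suc.prems])
qed (simp add: assms(1))

text \<open>The inner conjugate derivatives yield a convolution with a modified density, on which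
  the outer derivatives act in the same way.\<close>

lemma wirtinger_funpow_circle_conv:
  assumes "disc_smooth (k + l) g" and "norm z < 1" and \<phi>: "integrable circle_measure \<phi>"
  shows "(dz ^^ k) ((dzbar ^^ l) (circle_conv g \<phi>)) z
    = circle_conv ((dz ^^ k) ((dzbar ^^ l) g)) (\<lambda>t. cis (- real k * t) * (cis (real l * t) * \<phi> t)) z"
proof -
  have "disc_smooth l g" using assms(1)
  proof (induction k)
    case (Suc k)
    then show ?case using disc_smooth_Suc_lower[of "k + l" g] by (simp only: add_Suc)
  qed simp
  then have "(dz ^^ k) ((dzbar ^^ l) (circle_conv g \<phi>)) z
    = (dz ^^ k) (circle_conv ((dzbar ^^ l) g) (\<lambda>t. cis (real l * t) * \<phi> t)) z"
    by (intro funpow_dz_cong_ball funpow_dzbar_circle_conv assms)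
  also have "\<dots> = circle_conv ((dz ^^ k) ((dzbar ^^ l) g)) (\<lambda>t. cis (- real k * t) * (cis (real l * t) * \<phi> t)) z"
    by (intro funpow_dz_circle_conv integrable_cis_mult disc_smooth_funpow_dzbar assms)
  finally show ?thesis .
qed

section \<open>Parseval's identity and Euler's transformation\<close>

text \<open>Orthogonality of the characters, stated with \<open>has_bochner_integral\<close> so that
  finite sums and constant factors need no separate integrability proofs.\<close>

lemma has_bochner_integral_cis:
  fixes k :: int
  shows "has_bochner_integral circle_measure (\<lambda>t. cis (of_int k * t)) (if k = 0 then of_real (2 * pi) else 0)"
proof -
  have int: "integrable circle_measure (\<lambda>t. cis (of_int k * t))"
    by (intro continuous_imp_integrable_real continuous_intros)
  have "((\<lambda>t. cis (of_int k * t)) has_integral (LINT t|circle_measure. cis (of_int k * t))) {0..2 * pi}"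
    using int by (intro has_integral_integral_lebesgue_on) auto
  moreover have "((\<lambda>t. cis (of_int k * t)) has_integral (if k = 0 then of_real (2 * pi) else 0)) {0..2 * pi}"
  proof (cases "k = 0")
    case True
    then show ?thesis
      using has_integral_const_real[of "1::complex" 0 "2 * pi"] by (simp add: scaleR_conv_of_real)
  next
    case False
    have vd: "((\<lambda>t. cis (of_int k * t) / (\<i> * of_int k)) has_vector_derivative cis (of_int k * t)) (at t within {0..2*pi})" for t
    proof -
      have "((\<lambda>t. exp (\<i> * of_int k * of_real t) / (\<i> * of_int k)) has_vector_derivative
          exp (\<i> * of_int k * of_real t)) (at t within {0..2*pi})"
        using False by (auto intro!: derivative_eq_intros has_vector_derivative_real_field simp: field_simps)
      then show ?thesis by (simp add: cis_conv_exp mult.assoc)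
    qed
    have "((\<lambda>t. cis (of_int k * t)) has_integral
      (cis (of_int k * (2 * pi)) / (\<i> * of_int k) - cis (of_int k * 0) / (\<i> * of_int k))) {0..2 * pi}"
      by (rule fundamental_theorem_of_calculus[OF _ vd]) auto
    moreover have "cis (of_int k * (2 * pi)) = 1"
      using cis_multiple_2pi[of "of_int k"] by (simp add: mult_ac)
    ultimately show ?thesis using False by simp
  qed
  ultimately have "(LINT t|circle_measure. cis (of_int k * t)) = (if k = 0 then of_real (2 * pi) else 0)"
    by (rule has_integral_unique)
  then show ?thesis using has_bochner_integral_integrable[OF int] by simp
qed

text \<open>Expanding S times its conjugate gives a double sum in which only the diagonal survives
  integration.\<close>

lemma integral_trig_polynomial_norm_square:
  fixes a :: "nat \<Rightarrow> complex"
  shows "(LINT t|circle_measure. (norm (\<Sum>n<N. a n * cis (- t) ^ n))\<^sup>2) = 2 * pi * (\<Sum>n<N. (norm (a n))\<^sup>2)"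
proof -
  let ?S = "\<lambda>t. \<Sum>n<N. a n * cis (- t) ^ n"
  have eq: "complex_of_real ((norm (?S t))\<^sup>2)
    = (\<Sum>n<N. \<Sum>m<N. a n * cnj (a m) * cis (of_int (int m - int n) * t))" for t
  proof -
    have "complex_of_real ((norm (?S t))\<^sup>2) = ?S t * cnj (?S t)"
      by (simp only: complex_norm_square)
    also have "\<dots> = (\<Sum>n<N. \<Sum>m<N. (a n * cis (- t) ^ n) * cnj (a m * cis (- t) ^ m))"
      by (simp only: cnj_sum sum_product)
    also have "\<dots> = (\<Sum>n<N. \<Sum>m<N. a n * cnj (a m) * cis (of_int (int m - int n) * t))"
    proof (intro sum.cong refl)
      fix n m
      have "cis (- t) ^ n * cis t ^ m = cis (of_int (int m - int n) * t)"
        by (simp only: Complex.DeMoivre cis_mult) (simp add: algebra_simps)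
      moreover have "(a n * cis (- t) ^ n) * cnj (a m * cis (- t) ^ m)
          = a n * cnj (a m) * (cis (- t) ^ n * cis t ^ m)"
        by (simp add: cis_cnj)
      ultimately show "(a n * cis (- t) ^ n) * cnj (a m * cis (- t) ^ m)
          = a n * cnj (a m) * cis (of_int (int m - int n) * t)" by simp
    qed
    finally show ?thesis .
  qed
  have "has_bochner_integral circle_measure
      (\<lambda>t. \<Sum>n<N. \<Sum>m<N. a n * cnj (a m) * cis (of_int (int m - int n) * t))
      (\<Sum>n<N. \<Sum>m<N. a n * cnj (a m) * (if int m - int n = 0 then of_real (2 * pi) else 0))"
    by (intro has_bochner_integral_sum has_bochner_integral_mult_right has_bochner_integral_cis)
  also have "(\<Sum>n<N. \<Sum>m<N. a n * cnj (a m) * (if int m - int n = 0 then of_real (2 * pi) else 0))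
      = (\<Sum>n<N. of_real (2 * pi * (norm (a n))\<^sup>2))"
  proof (rule sum.cong[OF refl])
    fix n assume "n \<in> {..<N}"
    have "(\<Sum>m<N. a n * cnj (a m) * (if int m - int n = 0 then of_real (2 * pi) else 0))
        = (\<Sum>m<N. if m = n then a n * cnj (a n) * of_real (2 * pi) else 0)"
      by (intro sum.cong) auto
    also have "\<dots> = a n * cnj (a n) * of_real (2 * pi)" using \<open>n \<in> {..<N}\<close> by simp
    also have "\<dots> = of_real (2 * pi * (norm (a n))\<^sup>2)"
      by (simp only: of_real_mult complex_norm_square mult.commute)
    finally show "(\<Sum>m<N. a n * cnj (a m) * (if int m - int n = 0 then of_real (2 * pi) else 0))
        = of_real (2 * pi * (norm (a n))\<^sup>2)" .
  qed
  finally have "has_bochner_integral circle_measure (\<lambda>t. complex_of_real ((norm (?S t))\<^sup>2))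
      (\<Sum>n<N. of_real (2 * pi * (norm (a n))\<^sup>2))"
    by (simp only: eq)
  \<comment> \<open>The expansion lives in the complex numbers; taking real parts returns to the
    real integral.\<close>
  from has_bochner_integral_bounded_linear[OF bounded_linear_Re this]
  have "has_bochner_integral circle_measure (\<lambda>t. (norm (?S t))\<^sup>2) (\<Sum>n<N. 2 * pi * (norm (a n))\<^sup>2)"
    by simp
  then show ?thesis by (simp add: has_bochner_integral_integral_eq sum_distrib_left)
qed

text \<open>Dominated convergence from the partial sums, which are bounded by the sum of the
  coefficient norms; its square is the constant majorant.\<close>

lemma Parseval_circle:
  fixes a :: "nat \<Rightarrow> complex"
  assumes "summable (\<lambda>n. norm (a n))"
    and lim: "\<And>t. (\<lambda>n. a n * cis (- t) ^ n) sums f t"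
  shows "(\<lambda>n. 2 * pi * (norm (a n))\<^sup>2) sums (LINT t|circle_measure. (norm (f t))\<^sup>2)"
proof -
  let ?S = "\<lambda>N t. \<Sum>n<N. a n * cis (- t) ^ n"
  define B where "B = (\<Sum>n. norm (a n))"
  have meas: "?S N \<in> borel_measurable circle_measure" for N
    by (intro continuous_imp_measurable_on_sets_lebesgue continuous_intros) auto
  have conv: "(\<lambda>N. ?S N t) \<longlonglongrightarrow> f t" for t using lim by (simp add: sums_def)
  have "f \<in> borel_measurable circle_measure"
    by (rule borel_measurable_LIMSEQ_metric[OF meas conv])
  have "(\<lambda>N. LINT t|circle_measure. (norm (?S N t))\<^sup>2) \<longlonglongrightarrow> (LINT t|circle_measure. (norm (f t))\<^sup>2)"
  proof (rule integral_dominated_convergence[where w = "\<lambda>_. B\<^sup>2"])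
    show "(\<lambda>t. (norm (f t))\<^sup>2) \<in> borel_measurable circle_measure"
      using \<open>f \<in> borel_measurable circle_measure\<close> by measurable
    show "(\<lambda>t. (norm (?S N t))\<^sup>2) \<in> borel_measurable circle_measure" for N
      by (intro continuous_imp_measurable_on_sets_lebesgue continuous_intros) auto
    show "integrable circle_measure (\<lambda>_. B\<^sup>2)"
      by (intro continuous_imp_integrable_real continuous_intros)
    show "AE t in circle_measure. (\<lambda>N. (norm (?S N t))\<^sup>2) \<longlonglongrightarrow> (norm (f t))\<^sup>2"
      using conv by (intro AE_I2 tendsto_intros)
    fix N
    have "norm (?S N t) \<le> B" for t
    proof -
      have "norm (?S N t) \<le> (\<Sum>n<N. norm (a n))"
        by (rule order_trans[OF norm_sum]) (simp add: norm_mult norm_power)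
      also have "\<dots> \<le> B" unfolding B_def using assms(1) by (intro sum_le_suminf) auto
      finally show ?thesis .
    qed
    then show "AE t in circle_measure. norm ((norm (?S N t))\<^sup>2) \<le> B\<^sup>2"
      by (intro AE_I2) (simp add: power_mono)
  qed
  then show ?thesis
    unfolding integral_trig_polynomial_norm_square by (simp add: sums_def sum_distrib_left)
qed

text \<open>Parseval's identity for the binomial series of
  \<open>(1 - \<zeta> * cis (- t)) powr (- a)\<close>, whose coefficients are (a)_n / n! times
  powers of \<zeta>.\<close>

lemma circle_integral_powr_sums:
  fixes a :: real and \<zeta> :: complex
  assumes "norm \<zeta> < 1"
  shows "(\<lambda>n. 2 * pi * ((pochhammer a n / fact n)\<^sup>2 * ((norm \<zeta>)\<^sup>2) ^ n)) sums
    (LINT t|circle_measure. norm (1 - \<zeta> * cis (- t)) powr (- 2 * a))"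
proof -
  define b where "b n = ((of_real (- a) :: complex) gchoose n) * (- \<zeta>) ^ n" for n
  have nb: "(norm (b n))\<^sup>2 = (pochhammer a n / fact n)\<^sup>2 * ((norm \<zeta>)\<^sup>2) ^ n" for n
  proof -
    have "(of_real (- a) :: complex) gchoose n = of_real ((- 1) ^ n * (pochhammer a n / fact n))"
      by (simp add: gbinomial_pochhammer pochhammer_of_real)
    then have "norm (b n) = \<bar>pochhammer a n / fact n\<bar> * norm \<zeta> ^ n"
      by (simp add: b_def norm_mult norm_power abs_mult del: of_real_mult of_real_divide of_real_minus)
    then show ?thesis by (simp only: power_mult_distrib power2_abs power_mult[symmetric] mult.commute)
  qed
  have "summable (\<lambda>n. norm (b n))"
  proof -
    \<comment> \<open>Convergence at a radius beyond |\<zeta>| yields absolute convergence at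
      \<zeta>.\<close>
    define \<rho> where "\<rho> = (norm \<zeta> + 1) / 2"
    have "norm \<zeta> < \<rho>" "\<rho> < 1" "\<rho> > 0" using assms norm_ge_zero[of \<zeta>] by (auto simp: \<rho>_def simp del: norm_ge_zero)
    then have "summable (\<lambda>n. ((of_real (- a) :: complex) gchoose n) * of_real \<rho> ^ n)"
      by (intro sums_summable[OF gen_binomial_complex]) simp
    then show ?thesis unfolding b_def
      by (rule powser_insidea) (use \<open>norm \<zeta> < \<rho>\<close> \<open>\<rho> > 0\<close> in simp)
  qed
  moreover have "(\<lambda>n. b n * cis (- t) ^ n) sums ((1 - \<zeta> * cis (- t)) powr of_real (- a))" for t
  proof -
    have "norm (- \<zeta> * cis (- t)) < 1" using assms by (simp add: norm_mult)
    from gen_binomial_complex[OF this, of "of_real (- a)"] show ?thesis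
      by (simp add: b_def power_mult_distrib[symmetric] mult.assoc)
  qed
  ultimately have "(\<lambda>n. 2 * pi * (norm (b n))\<^sup>2) sums
      (LINT t|circle_measure. (norm ((1 - \<zeta> * cis (- t)) powr of_real (- a)))\<^sup>2)"
    by (rule Parseval_circle)
  moreover have "(norm ((1 - \<zeta> * cis (- t)) powr of_real (- a)))\<^sup>2 = norm (1 - \<zeta> * cis (- t)) powr (- 2 * a)" for t
    by (simp add: norm_powr_real_powr' power2_eq_square powr_add[symmetric])
  ultimately show ?thesis by (simp only: nb)
qed

text \<open>Since (1)_n = n!, the coefficients are squares, the same as in the preceding series;
  convergence is inherited from the case \<zeta> = \<open>sqrt x\<close>.\<close>

lemma hypergeo_F_sums:
  assumes "0 \<le> x" and "x < 1"
  shows "(\<lambda>n. (pochhammer a n / fact n)\<^sup>2 * x ^ n) sums hypergeo_F a a 1 x"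
proof -
  have "summable (\<lambda>n. 2 * pi * ((pochhammer a n / fact n)\<^sup>2 * ((norm (complex_of_real (sqrt x)))\<^sup>2) ^ n))"
    by (rule sums_summable[OF circle_integral_powr_sums]) (use assms in simp)
  then have "summable (\<lambda>n. (pochhammer a n / fact n)\<^sup>2 * x ^ n)"
    using assms by (subst (asm) summable_cmult_iff) simp
  moreover have "(\<lambda>n. (pochhammer a n / fact n)\<^sup>2 * x ^ n)
      = (\<lambda>n. pochhammer a n * pochhammer a n / pochhammer 1 n * (x ^ n / fact n))"
    by (simp add: pochhammer_fact[symmetric] power2_eq_square field_simps)
  ultimately show ?thesis unfolding hypergeo_F_def by (simp add: summable_sums)
qed

lemma circle_integral_powr:
  assumes "norm \<zeta> < 1"
  shows "(LINT t|circle_measure. norm (1 - \<zeta> * cis (- t)) powr (- 2 * a)) = 2 * pi * hypergeo_F a a 1 ((norm \<zeta>)\<^sup>2)"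
proof (rule sums_unique2[OF circle_integral_powr_sums[OF assms]])
  have "(norm \<zeta>)\<^sup>2 < 1" using assms by (simp add: abs_square_less_1)
  then show "(\<lambda>n. 2 * pi * ((pochhammer a n / fact n)\<^sup>2 * ((norm \<zeta>)\<^sup>2) ^ n)) sums (2 * pi * hypergeo_F a a 1 ((norm \<zeta>)\<^sup>2))"
    by (intro sums_mult hypergeo_F_sums) auto
qed

section \<open>Euler's transformation, first for formal power series and then for convergent
  ones\<close>

lemma pochhammer_over_fact_Suc:
  fixes a :: "'a :: field_char_0"
  shows "(1 + of_nat n) * (pochhammer a (Suc n) / fact (Suc n)) = (a + of_nat n) * (pochhammer a n / fact n)"
proof -
  have "(1 + of_nat n :: 'a) \<noteq> 0" using of_nat_neq_0[of n] by simp
  moreover have "fact (Suc n) = (1 + of_nat n) * (fact n :: 'a)" by simp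
  ultimately show ?thesis by (simp add: pochhammer_Suc del: fact_Suc)
qed

text \<open>The second factor is the series of (1 - X)^(2a - 1). The product satisfies the
  hypergeometric equation with \<open>1 - a\<close> in place of \<open>a\<close>, and that equation
  with constant term 1 determines all coefficients.\<close>

lemma fps_euler_transform:
  fixes a :: real
  defines "A \<equiv> \<lambda>a. Abs_fps (\<lambda>n. (pochhammer a n / fact n)\<^sup>2)"
  shows "A a * Abs_fps (\<lambda>n. pochhammer (1 - 2 * a) n / fact n) = A (1 - a)"
proof -
  \<comment> \<open>In terms of the Euler operator, the hypergeometric equation for \<open>F(a,a;1;X)\<close> reads \<open>D\<^sup>2 F = X (D + a)\<^sup>2 F\<close>.\<close>
  define D where "D F = fps_X * fps_deriv F" for F :: "real fps"
  define P where "P = Abs_fps (\<lambda>n. pochhammer (1 - 2 * a) n / fact n)"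
  define c where "c = fps_const a"
  have D_nth: "fps_nth (D F) n = of_nat n * fps_nth F n" for F n
    by (cases n) (simp_all add: D_def)
  have D_mult: "D (F * G) = D F * G + F * D G" for F G
    by (simp add: D_def algebra_simps)
  have D_add: "D (F + G) = D F + D G" for F G by (simp add: D_def algebra_simps)
  have D_diff: "D (F - G) = D F - D G" for F G by (simp add: D_def algebra_simps)
  have D_X: "D fps_X = fps_X" by (simp add: D_def)
  have D_const: "D (fps_const k) = 0" for k by (simp add: D_def)
  have X_nth: "fps_nth (fps_X * F) n = (if n = 0 then 0 else fps_nth F (n - 1))" for F :: "real fps" and n
    by simp
  have hA: "D (D (A a)) = fps_X * (D (D (A a)) + 2 * c * D (A a) + c * c * A a)"
  proof (rule fps_ext)
    fix n show "fps_nth (D (D (A a))) n = fps_nth (fps_X * (D (D (A a)) + 2 * c * D (A a) + c * c * A a)) n"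
    proof (cases n)
      case (Suc m)
      define q where "q = pochhammer a m / fact m"
      define q' where "q' = pochhammer a (Suc m) / fact (Suc m)"
      have qq': "((1 + real m) * q')\<^sup>2 = ((a + real m) * q)\<^sup>2"
        unfolding q_def q'_def by (simp only: pochhammer_over_fact_Suc)
      have A_nth: "fps_nth (A a) m = q\<^sup>2" "fps_nth (A a) (Suc m) = q'\<^sup>2"
        by (simp_all add: A_def q_def q'_def del: fact_Suc)
      have cc: "2 * c = fps_const (2 * a)" "c * c = fps_const (a * a)"
        by (simp_all add: c_def numeral_fps_const)
      have "fps_nth (D (D (A a))) n = ((1 + real m) * q')\<^sup>2"
        unfolding Suc D_nth A_nth by (simp add: power2_eq_square)
      also have "\<dots> = real m * (real m * q\<^sup>2) + 2 * a * (real m * q\<^sup>2) + a * a * q\<^sup>2"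
        unfolding qq' by (simp add: power2_eq_square algebra_simps)
      also have "\<dots> = fps_nth (fps_X * (D (D (A a)) + 2 * c * D (A a) + c * c * A a)) n"
        unfolding Suc X_nth cc by (simp add: D_nth A_nth)
      finally show ?thesis .
    qed (simp add: D_nth)
  qed
  have k: "2 * c - 1 = fps_const (2 * a - 1)"
    by (simp add: c_def numeral_fps_const flip: fps_const_1_eq_1)
  \<comment> \<open>The first-order equation of the power (1 - X)^(2a - 1), namely (1 - X) D P = -
    (2a - 1) X P.\<close>
  have hP: "D P = fps_X * (D P - (2 * c - 1) * P)"
  proof (rule fps_ext)
    fix n show "fps_nth (D P) n = fps_nth (fps_X * (D P - (2 * c - 1) * P)) n"
    proof (cases n)
      case (Suc m)
      define q where "q = pochhammer (1 - 2 * a) m / fact m"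
      define q' where "q' = pochhammer (1 - 2 * a) (Suc m) / fact (Suc m)"
      have "(1 + real m) * q' = (1 - 2 * a + real m) * q"
        unfolding q_def q'_def by (simp only: pochhammer_over_fact_Suc)
      moreover have "fps_nth P m = q" "fps_nth P (Suc m) = q'"
        by (simp_all add: P_def q_def q'_def del: fact_Suc)
      ultimately show ?thesis unfolding Suc k
        by (simp add: X_nth D_nth algebra_simps)
    qed (simp add: D_nth)
  qed
  define G where "G = A a * P"
  have DG: "D G = D (A a) * P + A a * D P" "D (D G) = D (D (A a)) * P + 2 * D (A a) * D P + A a * D (D P)"
    by (simp_all add: G_def D_mult D_add algebra_simps)
  have "D (fps_X * (D P - (2 * c - 1) * P)) = fps_X * (D P - (2 * c - 1) * P) + fps_X * (D (D P) - (2 * c - 1) * D P)"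
    unfolding k by (simp add: D_mult D_X D_diff D_const)
  then have DDP: "D (D P) = fps_X * (D P - (2 * c - 1) * P) + fps_X * (D (D P) - (2 * c - 1) * D P)"
    by (simp flip: hP)
  define X where "X = (fps_X :: real fps)"
  \<comment> \<open>Two factors 1 - X are what it takes to eliminate \<open>D P\<close> and
    \<open>D (D P)\<close> in favour of \<open>P\<close>. One of them is cancelled
    afterwards.\<close>
  have "(1 - X) * ((1 - X) * D (D G)) = (1 - X) * (X * (2 * (1 - c) * D G + (1 - c) * (1 - c) * G))"
  proof -
    have A2: "(1 - X) * D (D (A a)) = X * (2 * c * D (A a) + c * c * A a)"
      using hA unfolding X_def[symmetric] by algebra
    have P1: "(1 - X) * D P = - (2 * c - 1) * X * P"
      using hP unfolding X_def[symmetric] by algebra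
    have "(1 - X) * D (D P) = X * (D P - (2 * c - 1) * P) - (2 * c - 1) * X * D P"
      using DDP unfolding X_def[symmetric] by algebra
    then have "(1 - X) * ((1 - X) * D (D P)) = X * ((1 - X) * D P - (2 * c - 1) * (1 - X) * P) - (2 * c - 1) * X * ((1 - X) * D P)"
      by algebra
    also have "\<dots> = (2 * c - 1) * (2 * c - 1) * X * X * P - (2 * c - 1) * X * P"
      unfolding P1 by algebra
    finally have P2: "(1 - X) * ((1 - X) * D (D P)) = (2 * c - 1) * (2 * c - 1) * X * X * P - (2 * c - 1) * X * P" .
    have "(1 - X) * ((1 - X) * D (D G)) = (1 - X) * P * ((1 - X) * D (D (A a)))
        + 2 * (1 - X) * D (A a) * ((1 - X) * D P) + A a * ((1 - X) * ((1 - X) * D (D P)))"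
      unfolding DG(2) by algebra
    also have "\<dots> = (1 - X) * X * (2 * (1 - c) * (D (A a) * P) + (1 - c) * (1 - c) * G) + 2 * (1 - c) * X * A a * ((1 - X) * D P)"
      unfolding A2 P1 P2 G_def by algebra
    also have "\<dots> = (1 - X) * (X * (2 * (1 - c) * D G + (1 - c) * (1 - c) * G))"
      unfolding DG by algebra
    finally show ?thesis .
  qed
  moreover have "1 - X \<noteq> 0"
  proof
    assume "1 - X = 0"
    then have "fps_nth (1 - X) 0 = 0" by simp
    then show False by (simp add: X_def)
  qed
  ultimately have "(1 - X) * D (D G) = X * (2 * (1 - c) * D G + (1 - c) * (1 - c) * G)"
    using mult_left_cancel by blast
  then have ode: "D (D G) = fps_X * (D (D G) + 2 * (1 - c) * D G + (1 - c) * (1 - c) * G)"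
    unfolding X_def[symmetric] by algebra
  \<comment> \<open>Comparing coefficients of X^(m + 1) turns the equation into a two-term
    recurrence.\<close>
  have rec: "(1 + real m)\<^sup>2 * fps_nth G (Suc m) = (1 - a + real m)\<^sup>2 * fps_nth G m" for m
  proof -
    have cc: "2 * (1 - c) = fps_const (2 * (1 - a))" "(1 - c) * (1 - c) = fps_const ((1 - a) * (1 - a))"
      by (simp_all add: c_def numeral_fps_const flip: fps_const_1_eq_1)
    have "(1 + real m)\<^sup>2 * fps_nth G (Suc m) = fps_nth (D (D G)) (Suc m)"
      unfolding D_nth by (simp add: power2_eq_square)
    also have "\<dots> = fps_nth (fps_X * (D (D G) + 2 * (1 - c) * D G + (1 - c) * (1 - c) * G)) (Suc m)"
      by (rule arg_cong[OF ode])
    also have "\<dots> = real m * (real m * fps_nth G m) + 2 * (1 - a) * (real m * fps_nth G m) + (1 - a) * (1 - a) * fps_nth G m"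
      unfolding X_nth cc by (simp add: D_nth)
    also have "\<dots> = (1 - a + real m)\<^sup>2 * fps_nth G m"
      by (simp add: power2_eq_square algebra_simps)
    finally show ?thesis .
  qed
  have "G = A (1 - a)"
  proof (rule fps_ext)
    fix n show "fps_nth G n = fps_nth (A (1 - a)) n"
    proof (induction n)
      case 0
      show ?case by (simp add: G_def A_def P_def)
    next
      case (Suc m)
      have "(1 + real m)\<^sup>2 * fps_nth G (Suc m) = ((1 - a + real m) * (pochhammer (1 - a) m / fact m))\<^sup>2"
        using rec[of m] Suc by (simp only: A_def fps_nth_Abs_fps power_mult_distrib)
      also have "\<dots> = (1 + real m)\<^sup>2 * (pochhammer (1 - a) (Suc m) / fact (Suc m))\<^sup>2"
        by (simp only: pochhammer_over_fact_Suc[symmetric] power_mult_distrib)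
      finally have "fps_nth G (Suc m) = (pochhammer (1 - a) (Suc m) / fact (Suc m))\<^sup>2"
        by (simp del: fact_Suc)
      then show ?case by (simp add: A_def del: fact_Suc)
    qed
  qed
  then show ?thesis by (simp add: G_def P_def)
qed

text \<open>Both series converge absolutely, so their product is the Cauchy product, whose
  coefficients are given by the formal identity.\<close>

lemma hypergeo_F_euler_transform:
  assumes "0 \<le> x" and "x < 1"
  shows "(1 - x) powr (2 * a - 1) * hypergeo_F a a 1 x = hypergeo_F (1 - a) (1 - a) 1 x"
proof -
  let ?A = "\<lambda>n. (pochhammer a n / fact n)\<^sup>2 * x ^ n"
  let ?P = "\<lambda>n. pochhammer (1 - 2 * a) n / fact n * x ^ n"
  have binom: "((2 * a - 1) gchoose n) * (- z) ^ n = pochhammer (1 - 2 * a) n / fact n * z ^ n" for n and z :: real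
  proof -
    have "(- 1) ^ n * (- z) ^ n = z ^ n" by (simp flip: power_mult_distrib)
    moreover have "((2 * a - 1) gchoose n) * (- z) ^ n
        = pochhammer (1 - 2 * a) n / fact n * ((- 1) ^ n * (- z) ^ n)"
      by (simp add: gbinomial_pochhammer mult.commute mult.left_commute)
    ultimately show ?thesis by simp
  qed
  have sumsP: "(\<lambda>n. pochhammer (1 - 2 * a) n / fact n * z ^ n) sums (1 - z) powr (2 * a - 1)"
    if "\<bar>z\<bar> < 1" for z
    using gen_binomial_real[of "- z" "2 * a - 1"] that by (simp add: binom)
  have "summable (\<lambda>n. norm (?A n))"
    using sums_summable[OF hypergeo_F_sums[OF assms, of a]] assms(1) by simp
  moreover have "summable (\<lambda>n. norm (?P n))"
  proof (rule powser_insidea)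
    \<comment> \<open>The midpoint of \<open>x\<close> and 1 is still inside the unit interval and
      exceeds \<open>x\<close>, which gives absolute convergence at \<open>x\<close>.\<close>
    show "summable (\<lambda>n. pochhammer (1 - 2 * a) n / fact n * ((1 + x) / 2) ^ n)"
      using assms by (intro sums_summable[OF sumsP]) auto
  qed (use assms in auto)
  ultimately have "(\<lambda>n. \<Sum>i\<le>n. ?A i * ?P (n - i)) sums (suminf ?A * suminf ?P)"
    by (rule Cauchy_product_sums)
  moreover have "(\<Sum>i\<le>n. ?A i * ?P (n - i)) = (pochhammer (1 - a) n / fact n)\<^sup>2 * x ^ n" for n
  proof -
    have "(\<Sum>i\<le>n. ?A i * ?P (n - i))
        = (\<Sum>i\<le>n. (pochhammer a i / fact i)\<^sup>2 * (pochhammer (1 - 2 * a) (n - i) / fact (n - i))) * x ^ n"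
      unfolding sum_distrib_right
    proof (rule sum.cong[OF refl])
      fix i assume "i \<in> {..n}"
      then have "x ^ n = x ^ i * x ^ (n - i)" by (simp flip: power_add)
      then show "?A i * ?P (n - i)
        = (pochhammer a i / fact i)\<^sup>2 * (pochhammer (1 - 2 * a) (n - i) / fact (n - i)) * x ^ n"
        by simp
    qed
    also have "\<dots> = fps_nth (Abs_fps (\<lambda>n. (pochhammer a n / fact n)\<^sup>2) * Abs_fps (\<lambda>n. pochhammer (1 - 2 * a) n / fact n)) n * x ^ n"
      by (simp add: fps_mult_nth atLeast0AtMost)
    also have "\<dots> = (pochhammer (1 - a) n / fact n)\<^sup>2 * x ^ n"
      by (subst fps_euler_transform) simp
    finally show ?thesis .
  qed
  moreover have "suminf ?A = hypergeo_F a a 1 x" "suminf ?P = (1 - x) powr (2 * a - 1)"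
    using sums_unique[OF hypergeo_F_sums[OF assms]] sums_unique[OF sumsP[of x]] assms by auto
  ultimately show ?thesis
    using sums_unique2[OF _ hypergeo_F_sums[OF assms, of "1 - a"]] by (simp add: mult.commute)
qed

section \<open>Kernel bound and Young's inequality\<close>

text \<open>The modulus of a principal power w^c is |w|^(Re c) exp(- Im c Arg w). The two
  denominators have opposite arguments, so only Im (\<alpha> - \<beta>) enters, and these arguments
  are at most pi / 2 in size.\<close>

lemma norm_u_kernel_le:
  fixes \<alpha> \<beta> z :: complex
  assumes "norm z < 1"
  defines "s \<equiv> Re (\<alpha> + \<beta>)"
  shows "norm (u_kernel \<alpha> \<beta> z)
    \<le> exp (pi / 2 * \<bar>Im (\<alpha> - \<beta>)\<bar>) * ((1 - (norm z)\<^sup>2) powr (s + 1) * norm (1 - z) powr (- (s + 2)))"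
proof -
  have "(norm z)\<^sup>2 < 1" using assms by (simp add: abs_square_less_1)
  have "Re (1 - z) > 0" using complex_Re_le_cmod[of z] assms by simp
  then have arg: "\<bar>Arg (1 - z)\<bar> \<le> pi / 2" by (intro Arg_Re_nonneg[THEN iffD2]) simp
  \<comment> \<open>In the right half-plane the argument is an arctangent, which is odd.\<close>
  have argc: "Arg (1 - cnj z) = - Arg (1 - z)"
    using arg_conv_arctan[of "1 - z"] arg_conv_arctan[of "1 - cnj z"] \<open>Re (1 - z) > 0\<close>
    by (simp add: arctan_minus)
  have nc: "norm (1 - cnj z) = norm (1 - z)" by (metis complex_cnj_diff complex_cnj_one complex_mod_cnj)
  have num: "norm (of_real (1 - (norm z)\<^sup>2) powr (\<alpha> + \<beta> + 1)) = (1 - (norm z)\<^sup>2) powr (s + 1)"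
    using \<open>(norm z)\<^sup>2 < 1\<close> by (subst norm_powr_real_powr) (auto simp: s_def)
  have "norm ((1 - z) powr (\<alpha> + 1) * (1 - cnj z) powr (\<beta> + 1))
     = norm (1 - z) powr (s + 2) * exp (- (Im (\<alpha> - \<beta>) * Arg (1 - z)))"
    unfolding norm_mult norm_powr_complex argc nc
    by (simp add: s_def powr_add[symmetric] exp_add[symmetric] algebra_simps)
  then have "norm (u_kernel \<alpha> \<beta> z) = (1 - (norm z)\<^sup>2) powr (s + 1) * norm (1 - z) powr (- (s + 2)) * exp (Im (\<alpha> - \<beta>) * Arg (1 - z))"
    unfolding u_kernel_def norm_divide num by (simp only: powr_minus exp_minus) (simp add: field_simps)
  also have "\<dots> \<le> (1 - (norm z)\<^sup>2) powr (s + 1) * norm (1 - z) powr (- (s + 2)) * exp (pi / 2 * \<bar>Im (\<alpha> - \<beta>)\<bar>)"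
  proof -
    have "Im (\<alpha> - \<beta>) * Arg (1 - z) \<le> \<bar>Im (\<alpha> - \<beta>)\<bar> * \<bar>Arg (1 - z)\<bar>"
      by (simp flip: abs_mult)
    also have "\<dots> \<le> \<bar>Im (\<alpha> - \<beta>)\<bar> * (pi / 2)" using arg by (intro mult_left_mono) auto
    finally show ?thesis by (intro mult_left_mono) (auto simp: mult.commute)
  qed
  finally show ?thesis by (simp only: mult.commute)
qed

section \<open>Young's inequality through tangent lines of the power function\<close>

lemma powr_tangent_le:
  fixes m y p :: real
  assumes "1 \<le> p" "0 < m" "0 \<le> y"
  shows "m powr p + p * m powr (p - 1) * (y - m) \<le> y powr p"
proof (cases "y = 0")
  case True
  have "m powr p + p * m powr (p - 1) * (y - m) = (1 - p) * m powr p"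
    using assms(2) True by (simp add: powr_diff field_simps)
  also have "\<dots> \<le> 0" using assms(1) by (intro mult_nonpos_nonneg) auto
  finally show ?thesis using True by simp
next
  case False
  \<comment> \<open>Scaling by \<open>m\<close> reduces the claim to p z \<le> z^p + (p - 1), which
    is the weighted inequality of arithmetic and geometric means for z^p and 1 with weights 1/p and
    1 - 1/p.\<close>
  define z where "z = y / m"
  have "z > 0" using False assms by (simp add: z_def)
  have "(z powr p) powr (1 / p) * 1 powr (1 - 1 / p) \<le> 1 / p * z powr p + (1 - 1 / p) * 1"
    using assms \<open>z > 0\<close> Youngs_inequality_0[of "1 / p" "1 - 1 / p" "z powr p" 1] by simp
  then have "z \<le> 1 / p * z powr p + (1 - 1 / p)"
    using assms \<open>z > 0\<close> by (simp add: powr_powr)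
  then have "p * z \<le> p * (1 / p * z powr p + (1 - 1 / p))"
    using assms(1) by (intro mult_left_mono) auto
  also have "\<dots> = z powr p + (p - 1)" using assms(1) by (simp add: field_simps)
  finally have "p * z \<le> z powr p + (p - 1)" .
  then have "m powr p * (1 + p * (z - 1)) \<le> m powr p * z powr p"
    by (intro mult_left_mono) (auto simp: algebra_simps)
  also have "\<dots> = y powr p" using assms False by (simp add: z_def powr_divide)
  also have "m powr p * (1 + p * (z - 1)) = m powr p + p * m powr (p - 1) * (y - m)"
    using assms by (simp add: z_def powr_diff field_simps)
  finally show ?thesis .
qed

text \<open>Jensen's inequality for the probability density \<open>k / L\<close>, obtained by
  integrating the tangent line of the power function at the weighted mean.\<close>

lemma powr_weighted_mean_le:
  fixes k h :: "real \<Rightarrow> real"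
  assumes "1 \<le> p"
    and k: "\<And>t. 0 \<le> k t" "integrable M k" "integral\<^sup>L M k = L" "L > 0"
    and h: "\<And>t. 0 \<le> h t" "integrable M (\<lambda>t. k t * h t)" "integrable M (\<lambda>t. k t * h t powr p)"
  shows "(LINT t|M. k t * h t) powr p \<le> L powr (p - 1) * (LINT t|M. k t * h t powr p)"
proof (cases "(LINT t|M. k t * h t) = 0")
  case True
  then show ?thesis using k h by simp
next
  case False
  \<comment> \<open>At the weighted mean the linear term of the tangent integrates to zero.\<close>
  define m where "m = (LINT t|M. k t * h t) / L"
  have "(LINT t|M. k t * h t) \<ge> 0" using k h by simp
  then have "m > 0" using False \<open>L > 0\<close> by (simp add: m_def)
  let ?T = "\<lambda>t. m powr p * k t + p * m powr (p - 1) * (k t * h t - m * k t)"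
  have hb: "has_bochner_integral M ?T (m powr p * L + p * m powr (p - 1) * (m * L - m * L))"
  proof (intro has_bochner_integral_add has_bochner_integral_diff has_bochner_integral_mult_right)
    show "has_bochner_integral M k L" using k by (simp add: has_bochner_integral_iff)
    then show "has_bochner_integral M k L" .
    show "has_bochner_integral M (\<lambda>t. k t * h t) (m * L)"
      using h \<open>L > 0\<close> by (simp add: has_bochner_integral_iff m_def)
  qed
  have "m powr p * L = integral\<^sup>L M ?T" using has_bochner_integral_integral_eq[OF hb] by simp
  also have "\<dots> \<le> (LINT t|M. k t * h t powr p)"
  proof (rule integral_mono)
    show "integrable M ?T" using hb by (rule integrable.intros)
    fix t
    have "k t * (m powr p + p * m powr (p - 1) * (h t - m)) \<le> k t * h t powr p"
      by (intro mult_left_mono powr_tangent_le assms \<open>m > 0\<close>)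
    then show "?T t \<le> k t * h t powr p" by (simp add: algebra_simps)
  qed (rule h)
  finally have "m powr p * L \<le> (LINT t|M. k t * h t powr p)" .
  then have "L powr (p - 1) * (m powr p * L) \<le> L powr (p - 1) * (LINT t|M. k t * h t powr p)"
    by (intro mult_left_mono) auto
  moreover have "(LINT t|M. k t * h t) = m * L" using \<open>L > 0\<close> by (simp add: m_def)
  moreover have "L powr (p - 1) * (m powr p * L) = (m * L) powr p"
    using \<open>m > 0\<close> \<open>L > 0\<close> by (simp add: powr_mult powr_diff)
  ultimately show ?thesis by simp
qed

text \<open>A Schur test: the row integrals serve Jensen's inequality for each \<open>x\<close>, the
  column integrals serve after the order of integration is exchanged. The function \<open>v\<close>
  enters only through its pointwise majorant.\<close>

lemma Young_convolution_circle:
  fixes k :: "real \<Rightarrow> real \<Rightarrow> real" and h :: "real \<Rightarrow> real"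
  assumes "1 \<le> p"
    and cont: "continuous_on UNIV (\<lambda>(x, t). k x t)" and pos: "\<And>x t. 0 \<le> k x t"
    and row: "\<And>x. (LINT t|circle_measure. k x t) = L"
    and col: "\<And>t. (LINT x|circle_measure. k x t) = L"
    and "L > 0"
    and h: "\<And>t. 0 \<le> h t" "integrable circle_measure h" "integrable circle_measure (\<lambda>t. h t powr p)"
    and v: "\<And>x. 0 \<le> v x" "\<And>x. v x \<le> (LINT t|circle_measure. k x t * h t)"
  shows "(LINT x|circle_measure. v x powr p) \<le> L powr p * (LINT t|circle_measure. h t powr p)"
proof -
  interpret finite_measure circle_measure
    by (rule finite_measure_lebesgue_on) simp
  interpret pair_sigma_finite circle_measure circle_measure ..
  have cont1: "continuous_on S (\<lambda>t. k x t)" "continuous_on S (\<lambda>x. k x t)" for x t S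
  proof -
    have "continuous_on S (\<lambda>t. (\<lambda>(x, t). k x t) (x, t))" "continuous_on S (\<lambda>x. (\<lambda>(x, t). k x t) (x, t))"
      by (rule continuous_on_compose2[OF cont]; auto intro!: continuous_on_Pair)+
    then show "continuous_on S (\<lambda>t. k x t)" "continuous_on S (\<lambda>x. k x t)" by simp_all
  qed
  have int1: "integrable circle_measure (k x)" for x
    by (intro continuous_imp_integrable_real cont1)
  have int2: "integrable circle_measure (\<lambda>t. k x t * h t)" "integrable circle_measure (\<lambda>t. k x t * h t powr p)" for x
    by (intro integrable_continuous_mult cont1 h)+
  let ?W = "\<lambda>x. LINT t|circle_measure. k x t * h t powr p"
  have pw: "v x powr p \<le> L powr (p - 1) * ?W x" for x
  proof -
    have "v x powr p \<le> (LINT t|circle_measure. k x t * h t) powr p"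
      using v assms(1) by (intro powr_mono2) auto
    also have "\<dots> \<le> L powr (p - 1) * ?W x"
      by (rule powr_weighted_mean_le[OF assms(1) pos int1 row \<open>L > 0\<close> h(1) int2])
    finally show ?thesis .
  qed
  \<comment> \<open>The identity is measurable from the Lebesgue to the Borel sets, so the jointly
    continuous kernel is measurable for the product of the two circle measures.\<close>
  have id_borel: "id \<in> borel_measurable circle_measure"
    unfolding id_def by (intro continuous_imp_measurable_on_sets_lebesgue continuous_intros) auto
  have "(\<lambda>z. (fst z, snd z)) \<in> (circle_measure \<Otimes>\<^sub>M circle_measure) \<rightarrow>\<^sub>M (borel \<Otimes>\<^sub>M borel)"
    using measurable_compose[OF measurable_fst id_borel] measurable_compose[OF measurable_snd id_borel]
    by (intro measurable_Pair) (auto simp: id_def)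
  moreover have "(\<lambda>(x, t). k x t) \<in> borel_measurable (borel \<Otimes>\<^sub>M borel)"
    using borel_measurable_continuous_onI[OF cont] by (simp add: borel_prod)
  ultimately have "(\<lambda>(x, t). k x t) \<in> borel_measurable (circle_measure \<Otimes>\<^sub>M circle_measure)"
    using measurable_compose by fastforce
  moreover have "(\<lambda>z. h (snd z) powr p) \<in> borel_measurable (circle_measure \<Otimes>\<^sub>M circle_measure)"
    by (rule measurable_compose[OF measurable_snd borel_measurable_integrable[OF h(3)]])
  ultimately have meas: "(\<lambda>(x, t). k x t * h t powr p) \<in> borel_measurable (circle_measure \<Otimes>\<^sub>M circle_measure)"
    unfolding case_prod_beta by (rule borel_measurable_times)
  \<comment> \<open>With \<open>x\<close> as the inner variable the integral of the kernel is the
    constant \<open>L\<close>, so integrability reduces to that of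
    \<open>h t powr p\<close>.\<close>
  have swapped: "integrable (circle_measure \<Otimes>\<^sub>M circle_measure) (\<lambda>(t, x). k x t * h t powr p)"
  proof (rule Fubini_integrable)
    show "(\<lambda>(t, x). k x t * h t powr p) \<in> borel_measurable (circle_measure \<Otimes>\<^sub>M circle_measure)"
      using measurable_pair_swap[OF meas] by (simp add: case_prod_beta)
    have "(LINT x|circle_measure. norm (k x t * h t powr p)) = L * h t powr p" for t
      using pos by (simp add: col)
    then show "integrable circle_measure (\<lambda>t. LINT x|circle_measure. norm (case (t, x) of (t, x) \<Rightarrow> k x t * h t powr p))"
      using h(3) by simp
    show "AE t in circle_measure. integrable circle_measure (\<lambda>x. case (t, x) of (t, x) \<Rightarrow> k x t * h t powr p)"
      by (intro AE_I2) (simp add: continuous_imp_integrable_real[OF cont1(2)])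
  qed
  \<comment> \<open>A non-integrable left-hand side has integral 0 by convention; the nonnegative
    majorant covers that case.\<close>
  have "(LINT x|circle_measure. v x powr p) \<le> (LINT x|circle_measure. L powr (p - 1) * ?W x)"
  proof (rule integral_mono')
    show "integrable circle_measure (\<lambda>x. L powr (p - 1) * ?W x)"
      using integrable_snd[OF swapped] by simp
    show "v x powr p \<le> L powr (p - 1) * ?W x" for x by (rule pw)
    show "0 \<le> L powr (p - 1) * ?W x" for x using pos by simp
  qed
  also have "\<dots> = L powr (p - 1) * (LINT x|circle_measure. ?W x)" by simp
  also have "(LINT x|circle_measure. ?W x) = (LINT t|circle_measure. LINT x|circle_measure. k x t * h t powr p)"
    by (rule Fubini_integral[OF swapped])
  also have "\<dots> = L * (LINT t|circle_measure. h t powr p)" by (simp add: col)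
  also have "L powr (p - 1) * \<dots> = L powr p * (LINT t|circle_measure. h t powr p)"
    using \<open>L > 0\<close> by (simp add: powr_diff)
  finally show ?thesis .
qed

section \<open>The bound on the integral means, assembled from the kernel estimate, the circle mean
  and Young's inequality\<close>

theorem theorem3:
  fixes \<alpha> \<beta> :: complex and k l :: nat and p C r :: real and f :: "complex \<Rightarrow> complex"
  assumes "\<alpha> \<notin> of_int ` {n::int. n < 0}"
    and "\<beta> \<notin> of_int ` {n::int. n < 0}"
    and "Re (\<alpha> + \<beta>) > -1"
    and "1 \<le> p"
    and "f \<in> Lp_circle p"
    and "\<And>z. norm z < 1 \<Longrightarrow>
           norm ((dz ^^ k) ((dzbar ^^ l) (u_kernel \<alpha> \<beta>)) z)
             \<le> C * norm (u_kernel \<alpha> \<beta> z) / (1 - (norm z)\<^sup>2) ^ (k + l)"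
    and "0 \<le> r" and "r < 1"
  shows "integral_mean p r ((dz ^^ k) ((dzbar ^^ l) (K_transform \<alpha> \<beta> f)))
           \<le> norm (c_const \<alpha> \<beta>) * C / (1 - r\<^sup>2) ^ (k + l)
             * exp (pi / 2 * \<bar>Im (\<alpha> - \<beta>)\<bar>)
             * hypergeo_F (- Re (\<alpha> + \<beta>) / 2) (- Re (\<alpha> + \<beta>) / 2) 1 (r\<^sup>2)
             * Lp_circle_norm p f"
proof -
  define s where "s = Re (\<alpha> + \<beta>)"
  define E where "E = exp (pi / 2 * \<bar>Im (\<alpha> - \<beta>)\<bar>)"
  define F where "F = hypergeo_F (- s / 2) (- s / 2) 1 (r\<^sup>2)"
  define B where "B = norm (c_const \<alpha> \<beta>) * C / (1 - r\<^sup>2) ^ (k + l) * E"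
  define Du where "Du = (dz ^^ k) ((dzbar ^^ l) (u_kernel \<alpha> \<beta>))"
  define h where "h t = norm (f (cis t))" for t
  \<comment> \<open>The majorant of |u| at the point r exp(i (x - t)), without the exponential
    factor, which is part of \<open>B\<close>.\<close>
  define \<kappa> where "\<kappa> x t = (1 - r\<^sup>2) powr (s + 1) * norm (1 - of_real r * cis x * cis (- t)) powr (- (s + 2))" for x t
  define \<phi> where "\<phi> t = c_const \<alpha> \<beta> / of_real (2 * pi) * f (cis t)" for t
  have "r\<^sup>2 < 1" using assms by (simp add: abs_square_less_1)
  \<comment> \<open>At the origin the kernel equals 1, so the assumed bound there has
    \<open>C\<close> alone on the right.\<close>
  have "C \<ge> 0"
  proof -
    have "0 \<le> norm (Du 0)" by simp
    also have "\<dots> \<le> C" using assms(6)[of 0] by (simp add: u_kernel_def Du_def)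
    finally show ?thesis .
  qed
  then have "B \<ge> 0" using \<open>r\<^sup>2 < 1\<close> by (simp add: B_def E_def)
  have fm: "(\<lambda>t. f (cis t)) \<in> borel_measurable circle_measure" and hp: "integrable circle_measure (\<lambda>t. h t powr p)"
    using assms(5) by (auto simp: Lp_circle_def h_def)
  \<comment> \<open>On a finite measure space L^p lies in L^1, by
    \<open>h t \<le> 1 + h t powr p\<close>; differentiation under the integral needs an integrable
    density.\<close>
  have f1: "integrable circle_measure (\<lambda>t. f (cis t))"
  proof (rule Bochner_Integration.integrable_bound[OF _ fm])
    show "integrable circle_measure (\<lambda>t. 1 + h t powr p)"
      by (intro Bochner_Integration.integrable_add hp continuous_imp_integrable_real continuous_intros)
    have "h t \<le> 1 + h t powr p" for t
    proof (cases "h t \<le> 1")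
      case False
      then have "h t powr 1 \<le> h t powr p" using assms(4) by (intro powr_mono) auto
      then show ?thesis using False by simp
    qed (simp add: add_increasing2)
    then show "AE t in circle_measure. norm (f (cis t)) \<le> norm (1 + h t powr p)"
      by (intro AE_I2) (simp add: h_def)
  qed
  then have h1: "integrable circle_measure h" and \<phi>1: "integrable circle_measure \<phi>"
    unfolding h_def \<phi>_def by auto
  have Kt: "K_transform \<alpha> \<beta> f = circle_conv (u_kernel \<alpha> \<beta>) \<phi>"
  proof
    fix z
    show "K_transform \<alpha> \<beta> f z = circle_conv (u_kernel \<alpha> \<beta>) \<phi> z"
      unfolding K_transform_def circle_conv_def integral_mult_right_zero[symmetric]
      by (intro Bochner_Integration.integral_cong) (auto simp: K_kernel_def \<phi>_def)
  qed
  let ?v = "\<lambda>x. norm ((dz ^^ k) ((dzbar ^^ l) (K_transform \<alpha> \<beta> f)) (of_real r * cis x))"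
  have nz: "1 - of_real r * cis x * cis (- t) \<noteq> 0" for x t
  proof
    assume "1 - of_real r * cis x * cis (- t) = 0"
    then have "norm (of_real r * cis x * cis (- t)) = 1" by simp
    then show False using assms(7,8) by (simp add: norm_mult)
  qed
  have cont\<kappa>: "continuous_on UNIV (\<lambda>(x, t). \<kappa> x t)"
    unfolding \<kappa>_def case_prod_beta by (intro continuous_intros) (use nz in auto)
  have cont\<kappa>1: "continuous_on S (\<lambda>t. \<kappa> x t)" for x S
    unfolding \<kappa>_def by (intro continuous_intros) (use nz in auto)
  have \<kappa>_nonneg: "0 \<le> \<kappa> x t" for x t by (simp add: \<kappa>_def)
  \<comment> \<open>The factors that the derivatives leave in the density have modulus one and
    disappear here.\<close>
  have bound: "?v x \<le> (LINT t|circle_measure. \<kappa> x t * (B / (2 * pi) * h t))" for x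
  proof -
    define \<psi> where "\<psi> t = cis (- real k * t) * (cis (real l * t) * \<phi> t)" for t
    have z: "norm (of_real r * cis x) < 1" using assms(7,8) by (simp add: norm_mult)
    have "?v x = norm (LINT t|circle_measure. Du (of_real r * cis x * cis (- t)) * \<psi> t)"
      unfolding Kt wirtinger_funpow_circle_conv[OF disc_smooth_u_kernel z \<phi>1] Du_def \<psi>_def
      by (simp only: circle_conv_def)
    also have "\<dots> \<le> (LINT t|circle_measure. \<kappa> x t * (B / (2 * pi) * h t))"
    proof (rule Bochner_Integration.integral_norm_bound_integral)
      have "disc_smooth 0 Du" unfolding Du_def
        by (intro disc_smooth_funpow_dz disc_smooth_funpow_dzbar disc_smooth_u_kernel)
      then show "integrable circle_measure (\<lambda>t. Du (of_real r * cis x * cis (- t)) * \<psi> t)"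
        unfolding \<psi>_def
        by (intro integrable_circle_conv integrable_cis_mult \<phi>1 z disc_smooth_imp_continuous)
      show "integrable circle_measure (\<lambda>t. \<kappa> x t * (B / (2 * pi) * h t))"
        by (intro integrable_continuous_mult cont\<kappa>1 integrable_mult_right h1)
      fix t
      define w where "w = of_real r * cis x * cis (- t)"
      have w: "norm w = r" using assms(7) by (simp add: w_def norm_mult)
      have "norm (Du w) \<le> C * norm (u_kernel \<alpha> \<beta> w) / (1 - r\<^sup>2) ^ (k + l)"
        using assms(6)[of w] assms(8) by (simp add: w Du_def)
      also have "\<dots> \<le> C * (E * \<kappa> x t) / (1 - r\<^sup>2) ^ (k + l)"
        using norm_u_kernel_le[of w \<alpha> \<beta>] w \<open>C \<ge> 0\<close> \<open>r\<^sup>2 < 1\<close> assms(8)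
        by (intro divide_right_mono mult_left_mono) (simp_all add: E_def \<kappa>_def s_def w_def)
      finally have "norm (Du w) * norm (\<phi> t) \<le> C * (E * \<kappa> x t) / (1 - r\<^sup>2) ^ (k + l) * norm (\<phi> t)"
        by (rule mult_right_mono) simp
      then show "norm (Du (of_real r * cis x * cis (- t)) * \<psi> t) \<le> \<kappa> x t * (B / (2 * pi) * h t)"
        by (simp add: w_def \<psi>_def \<phi>_def B_def h_def norm_mult norm_divide mult.commute mult.left_commute)
    qed
    finally show ?thesis .
  qed
  \<comment> \<open>With a = 1 + s/2 the exponent -2a is - (s + 2). Euler's transformation then
    needs the power 2a - 1 = s + 1, exactly the one in \<open>\<kappa>\<close>, and produces the
    parameters 1 - a = - s/2.\<close>
  have L: "(LINT t|circle_measure. \<kappa> x t) = 2 * pi * F" for x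
  proof -
    have "(LINT t|circle_measure. \<kappa> x t) = (1 - r\<^sup>2) powr (s + 1) *
        (LINT t|circle_measure. norm (1 - of_real r * cis x * cis (- t)) powr (- (s + 2)))"
      by (simp add: \<kappa>_def)
    also have "(LINT t|circle_measure. norm (1 - of_real r * cis x * cis (- t)) powr (- (s + 2)))
        = 2 * pi * hypergeo_F (1 + s / 2) (1 + s / 2) 1 (r\<^sup>2)"
    proof -
      have "- 2 * (1 + s / 2) = - (s + 2)" "norm (of_real r * cis x) = r"
        using assms(7) by (simp_all add: norm_mult)
      then show ?thesis
        using circle_integral_powr[of "of_real r * cis x" "1 + s / 2"] assms(8) by (simp only:)
    qed
    also have "(1 - r\<^sup>2) powr (s + 1) * \<dots> = 2 * pi * F"
      using hypergeo_F_euler_transform[of "r\<^sup>2" "1 + s / 2"] \<open>r\<^sup>2 < 1\<close>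
      by (simp add: F_def mult.left_commute add.commute)
    finally show ?thesis .
  qed
  \<comment> \<open>Conjugation exchanges the two angles, so the column integrals follow from the
    row integrals.\<close>
  have \<kappa>_sym: "\<kappa> x t = \<kappa> t x" for x t
  proof -
    have "cnj (1 - of_real r * cis x * cis (- t)) = 1 - of_real r * cis t * cis (- x)"
      by (simp add: cis_cnj mult.commute mult.left_commute)
    then have "norm (1 - of_real r * cis x * cis (- t)) = norm (1 - of_real r * cis t * cis (- x))"
      by (metis complex_mod_cnj)
    then show ?thesis by (simp add: \<kappa>_def)
  qed
  have L': "(LINT x|circle_measure. \<kappa> x t) = 2 * pi * F" for t
    using L[of t] by (simp add: \<kappa>_sym[of _ t])
  \<comment> \<open>All terms of the series are nonnegative and the zeroth one is 1.\<close>
  have "F > 0"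
  proof -
    have sums: "(\<lambda>n. (pochhammer (- s / 2) n / fact n)\<^sup>2 * (r\<^sup>2) ^ n) sums F"
      unfolding F_def using \<open>r\<^sup>2 < 1\<close> by (intro hypergeo_F_sums) auto
    have "(\<Sum>n<1. (pochhammer (- s / 2) n / fact n)\<^sup>2 * (r\<^sup>2) ^ n) \<le> F"
      unfolding sums_unique[OF sums] by (intro sum_le_suminf sums_summable[OF sums]) auto
    then show ?thesis by simp
  qed
  define H where "H = 1 / (2 * pi) * (LINT t|circle_measure. h t powr p)"
  have "H \<ge> 0" by (simp add: H_def)
  have Bh: "(B / (2 * pi) * h t) powr p = (B / (2 * pi)) powr p * h t powr p" for t
    using \<open>B \<ge> 0\<close> by (intro powr_mult)
  \<comment> \<open>Young's inequality with total mass \<open>2 * pi * F\<close> and the density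
    scaled by \<open>B / (2 * pi)\<close>; the factors 2 pi cancel in the product.\<close>
  have "(LINT x|circle_measure. ?v x powr p) \<le> (2 * pi * F) powr p * (LINT t|circle_measure. (B / (2 * pi) * h t) powr p)"
  proof (rule Young_convolution_circle[OF assms(4) cont\<kappa> \<kappa>_nonneg L L' _ _ _ _ _ bound])
    show "integrable circle_measure (\<lambda>t. (B / (2 * pi) * h t) powr p)"
      unfolding Bh using hp by simp
    show "integrable circle_measure (\<lambda>t. B / (2 * pi) * h t)" using h1 by simp
  qed (use \<open>F > 0\<close> \<open>B \<ge> 0\<close> in \<open>auto simp: h_def\<close>)
  then have "1 / (2 * pi) * (LINT x|circle_measure. ?v x powr p)
      \<le> 1 / (2 * pi) * ((2 * pi * F) powr p * (LINT t|circle_measure. (B / (2 * pi) * h t) powr p))"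
    by (intro mult_left_mono) auto
  also have "\<dots> = (2 * pi * F) powr p * (B / (2 * pi)) powr p * H"
    unfolding Bh H_def by simp
  also have "\<dots> = (B * F) powr p * H"
    using \<open>B \<ge> 0\<close> \<open>F > 0\<close> by (simp add: mult.commute flip: powr_mult)
  finally have "integral_mean p r ((dz ^^ k) ((dzbar ^^ l) (K_transform \<alpha> \<beta> f))) \<le> ((B * F) powr p * H) powr (1 / p)"
    unfolding integral_mean_def using assms(4) by (intro powr_mono2) auto
  also have "\<dots> = B * F * H powr (1 / p)"
    using \<open>B \<ge> 0\<close> \<open>F > 0\<close> \<open>H \<ge> 0\<close> assms(4) by (simp add: powr_mult powr_powr)
  also have "\<dots> = norm (c_const \<alpha> \<beta>) * C / (1 - r\<^sup>2) ^ (k + l) * E * F * Lp_circle_norm p f"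
    by (simp add: B_def Lp_circle_norm_def H_def h_def)
  finally show ?thesis by (simp add: E_def F_def s_def)
qed

end
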